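(* Let $d$ be a positive integer. Let $X:=(X_k, k\in\mathbb{Z}^d)$ be a strictly stationary $\rho'$-mixing random field of real-valued random variables such that $EX_0=0$ and $EX_0^2<\infty$. For $L=(L_1,\ldots,L_d)\in\mathbb{N}^d$ let $S(X,L):=\sum_k X_k$, the sum being over all $k=(k_1,\ldots,k_d)\in\mathbb{N}^d$ with $1\le k_u\le L_u$ for all $u\in\{1,\ldots,d\}$. Then the following two statements hold: (I) The quantity $$\sigma^2:=\lim_{\min\{L_1,L_2,\ldots,L_d\}\to\infty}\frac{E\,S(X,L)^2}{L_1\cdot L_2\cdots L_d}$$ exists in $[0,\infty)$. (II) As $\min\{L_1,L_2,\ldots,L_d\}\to\infty$, $$(L_1\cdot L_2\cdots L_d)^{-1/2}\,S(X,L)\Rightarrow N(0,\sigma^2),$$ where $\Rightarrow$ denotes convergence in distribution.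
   Context: $\mathbb{N}=\{1,2,3,\ldots\}$. All random variables are defined on a probability space $(\Omega,\mathcal{F},P)$. A random field $X=(X_k,k\in\mathbb{Z}^d)$ is strictly stationary if its joint distributions are invariant under shifts of the index by elements of $\mathbb{Z}^d$. For $\sigma$-fields $\mathcal{A},\mathcal{B}\subseteq\mathcal{F}$, the maximal coefficient of correlation is $$\rho(\mathcal{A},\mathcal{B}):=\sup|\mathrm{Corr}(f,g)|,\quad f\in L^2_{\mathrm{real}}(\mathcal{A}),\ g\in L^2_{\mathrm{real}}(\mathcal{B}),$$ where $L^2_{\mathrm{real}}(\mathcal{A})$ is the set of real-valued, square-integrable, $\mathcal{A}$-measurable random variables (pairs with a degenerate member contribute $0$). For a strictly stationary random field $X=(X_k,k\in\mathbb{Z}^d)$ and a positive integer $n$, $$\rho'(n)=\rho'(X,n):=\sup\rho(\sigma(X_k,k\in Q),\sigma(X_k,k\in S)),$$ where the supremum is over all pairs of nonempty, finite, disjoint sets $Q,S\subset\mathbb{Z}^d$ with the following property: there exist $u\in\{1,\ldots,d\}$ and nonempty disjoint sets $A,B\subset\mathbb{Z}$ with $\mathrm{dist}(A,B):=\min_{a\in A,b\in B}|a-b|\ge n$ such that $Q\subset\{k=(k_1,\ldots,k_d)\in\mathbb{Z}^d: k_u\in A\}$ and $S\subset\{k=(k_1,\ldots,k_d)\in\mathbb{Z}^d: k_u\in B\}$. The random field $X$ is $\rho'$-mixing if $\rho'(n)\to0$ as $n\to\infty$. $N(0,\sigma^2)$ is the normal law with mean $0$ and variance $\sigma^2$ (the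 point mass at $0$ if $\sigma^2=0$). For an array $(a(L),L\in\mathbb{N}^d)$, the limit as $\min\{L_1,\ldots,L_d\}\to\infty$ is taken along all $L\in\mathbb{N}^d$ with all coordinates tending to infinity, in an arbitrary manner relative to each other. *)

theory Defs
  imports "HOL-Probability.Probability"
begin

text \<open>
  The dimension \<open>d\<close> is \<open>CARD('d)\<close>, and \<open>\<int>\<^sup>d\<close> is \<open>int ^ 'd\<close>. Throughout,
  \<open>M\<close> is the underlying probability space, and a sub-sigma-field \<open>\<A>\<close> of \<open>sets M\<close> is
  represented by a measure \<open>A\<close> with \<open>space A = space M\<close> and \<open>sets A = \<A>\<close>; the values of
  \<open>A\<close> as a measure play no role.
\<close>

definition random_field :: "'a measure \<Rightarrow> (int ^ 'd \<Rightarrow> 'a \<Rightarrow> real) \<Rightarrow> bool" where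
  "random_field M X \<longleftrightarrow> (\<forall>k. X k \<in> borel_measurable M)"

definition strictly_stationary :: "'a measure \<Rightarrow> (int ^ 'd \<Rightarrow> 'a \<Rightarrow> real) \<Rightarrow> bool" where
  "strictly_stationary M X \<longleftrightarrow>
     (\<forall>h I. finite I \<longrightarrow>
        distr M (Pi\<^sub>M I (\<lambda>_. borel)) (\<lambda>\<omega>. \<lambda>k\<in>I. X (k + h) \<omega>) =
        distr M (Pi\<^sub>M I (\<lambda>_. borel)) (\<lambda>\<omega>. \<lambda>k\<in>I. X k \<omega>))"

definition gen_field :: "'a measure \<Rightarrow> ('i \<Rightarrow> 'a \<Rightarrow> real) \<Rightarrow> 'i set \<Rightarrow> 'a measure" where
  "gen_field M X Q = sigma (space M) {X k -` U \<inter> space M | k U. k \<in> Q \<and> U \<in> sets borel}"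

definition L2_real :: "'a measure \<Rightarrow> 'a measure \<Rightarrow> ('a \<Rightarrow> real) set" where
  "L2_real M A = {f \<in> borel_measurable A. integrable M (\<lambda>\<omega>. (f \<omega>)\<^sup>2)}"

definition cov :: "'a measure \<Rightarrow> ('a \<Rightarrow> real) \<Rightarrow> ('a \<Rightarrow> real) \<Rightarrow> real" where
  "cov M f g = prob_space.expectation M
     (\<lambda>\<omega>. (f \<omega> - prob_space.expectation M f) * (g \<omega> - prob_space.expectation M g))"

text \<open>Degenerate members give correlation \<open>0\<close> because \<open>x / 0 = 0\<close>.\<close>

definition corr :: "'a measure \<Rightarrow> ('a \<Rightarrow> real) \<Rightarrow> ('a \<Rightarrow> real) \<Rightarrow> real" where
  "corr M f g = cov M f g / sqrt (prob_space.variance M f * prob_space.variance M g)"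

text \<open>
  Both suprema below are suprema of nonempty sets of reals contained in \<open>[0, 1]\<close>
  (by Cauchy-Schwarz), so that the real-valued \<open>SUP\<close> is the genuine supremum.
\<close>

definition max_corr :: "'a measure \<Rightarrow> 'a measure \<Rightarrow> 'a measure \<Rightarrow> real" where
  "max_corr M A B = (SUP (f, g) \<in> L2_real M A \<times> L2_real M B. \<bar>corr M f g\<bar>)"

definition separated_pairs :: "nat \<Rightarrow> ((int ^ 'd) set \<times> (int ^ 'd) set) set" where
  "separated_pairs n =
     {(Q, S). Q \<noteq> {} \<and> S \<noteq> {} \<and> finite Q \<and> finite S \<and> Q \<inter> S = {} \<and>
        (\<exists>u A B. A \<noteq> {} \<and> B \<noteq> {} \<and> A \<inter> B = {} \<and> setdist A B \<ge> real n \<and>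
           Q \<subseteq> {k. k $ u \<in> A} \<and> S \<subseteq> {k. k $ u \<in> B})}"

definition rho_prime :: "'a measure \<Rightarrow> (int ^ 'd \<Rightarrow> 'a \<Rightarrow> real) \<Rightarrow> nat \<Rightarrow> real" where
  "rho_prime M X n =
     (SUP (Q, S) \<in> separated_pairs n. max_corr M (gen_field M X Q) (gen_field M X S))"

definition rho_prime_mixing :: "'a measure \<Rightarrow> (int ^ 'd \<Rightarrow> 'a \<Rightarrow> real) \<Rightarrow> bool" where
  "rho_prime_mixing M X \<longleftrightarrow> rho_prime M X \<longlonglongrightarrow> 0"

definition box_sum :: "(int ^ 'd \<Rightarrow> 'a \<Rightarrow> real) \<Rightarrow> nat ^ 'd \<Rightarrow> 'a \<Rightarrow> real" where
  "box_sum X L \<omega> = (\<Sum>k\<in>{k. \<forall>u. 1 \<le> k $ u \<and> k $ u \<le> int (L $ u)}. X k \<omega>)"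

definition box_vol :: "nat ^ 'd \<Rightarrow> real" where
  "box_vol L = (\<Prod>u\<in>UNIV. real (L $ u))"

text \<open>
  The filter of \<open>min {L\<^sub>1, \<dots>, L\<^sub>d} \<rightarrow> \<infinity>\<close>. Indices \<open>L\<close> with a zero
  coordinate are harmless, since eventually all coordinates are positive.
\<close>

definition min_at_top :: "(nat ^ 'd) filter" where
  "min_at_top = filtercomap (\<lambda>L. MIN u. L $ u) at_top"

definition normal_law :: "real \<Rightarrow> real measure" where
  "normal_law v = (if v = 0 then return borel 0 else density lborel (normal_density 0 (sqrt v)))"

text \<open>The analogue of \<^const>\<open>weak_conv_m\<close> along an arbitrary filter.\<close>

definition weak_conv_filter :: "('i \<Rightarrow> real measure) \<Rightarrow> real measure \<Rightarrow> 'i filter \<Rightarrow> bool" where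
  "weak_conv_filter \<mu> \<nu> F \<longleftrightarrow>
     (\<forall>x. isCont (cdf \<nu>) x \<longrightarrow> ((\<lambda>i. cdf (\<mu> i) x) \<longlongrightarrow> cdf \<nu> x) F)"

end

theory Submission
  imports Defs
begin

text \<open>
  Two mechanisms drive the proof. The first is the interlaced form of the mixing condition. If
  finitely many centred variables \<open>Y\<^sub>i\<close> are such that any two sums over complementary index sets
  have correlation at most \<open>r\<close>, then flipping the signs of some of the \<open>Y\<^sub>i\<close> changes the variance
  of their sum by a factor of at most \<open>(1 + r) / (1 - r)\<close>; averaging over all sign patterns shows
  that the variance of the sum and the sum of the variances agree up to that factor
  (\<open>interlaced_second_moment\<close>). Applied one coordinate after the other, this gives
  \<open>E S(Q)\<^sup>2 \<le> C \<bar>Q\<bar> E X\<^sub>0\<^sup>2\<close> for every finite \<open>Q\<close> (\<open>second_moment_bound\<close>).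

  The second mechanism is to cut a box along a single coordinate into blocks separated by short
  gaps. The gaps cover a small part of the box, so the second moment bound makes them negligible,
  and the blocks are nearly uncorrelated translates of one smaller box. This shows that
  \<open>E S(L)\<^sup>2 / vol(L)\<close> hardly changes when one side of the box is replaced by a moderate length,
  with an error that does not depend on the other sides. Replacing the sides one at a time
  compares every large box with one fixed cube, which yields statement (I)
  (\<open>normalized_variance_converges\<close>).

  For statement (II), take a fixed number \<open>m\<close> of blocks. Once \<open>m\<close> is fixed, a sufficiently long gap
  \<open>q\<close> makes the total mixing error \<open>4 m r(q)\<close> as small as desired, whatever the rate of mixing, and such
  gaps are still negligible in a large box; hence the characteristic function of \<open>S(L)\<close> is close to
  the \<open>m\<close>-th power of that of a block (\<open>char_box_power\<close>). A quadratic expansion of that factor, the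
  convergence of the variances and \<open>(1 - x / m)\<^sup>m \<rightarrow> exp (- x)\<close> identify the limit (\<open>char_tendsto_normal\<close>), and Levy's theorem
  concludes. The expansion requires the normalized squares \<open>S(L)\<^sup>2 / vol(L)\<close> to be uniformly
  integrable. This comes from truncating the variables: for a bounded field the fourth moments are
  of order \<open>vol(L)\<^sup>2\<close> (\<open>fourth_moment_bound\<close>), and the remainder is a field of the same kind with a
  small variance, to which the second moment bound applies with the same constant
  (\<open>truncated_third_moment_bound\<close>).
\<close>

section \<open>Square-integrable functions\<close>

definition square_integrable :: "'a measure \<Rightarrow> ('a \<Rightarrow> real) \<Rightarrow> bool" where
  "square_integrable M f \<longleftrightarrow> f \<in> borel_measurable M \<and> integrable M (\<lambda>x. (f x)\<^sup>2)"

lemma square_integrable_mult: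
  assumes "square_integrable M f" "square_integrable M g"
  shows "integrable M (\<lambda>x. f x * g x)"
proof (rule Bochner_Integration.integrable_bound)
  show "integrable M (\<lambda>x. (f x)\<^sup>2 + (g x)\<^sup>2)"
    using assms by (auto simp: square_integrable_def)
  show "(\<lambda>x. f x * g x) \<in> borel_measurable M"
    using assms by (auto simp: square_integrable_def)
  have "\<bar>a * b\<bar> \<le> \<bar>a\<^sup>2 + b\<^sup>2\<bar>" for a b :: real
  proof -
    have "0 \<le> (\<bar>a\<bar> - \<bar>b\<bar>)\<^sup>2" "0 \<le> \<bar>a\<bar> * \<bar>b\<bar>" by simp_all
    moreover have "(\<bar>a\<bar> - \<bar>b\<bar>)\<^sup>2 = a\<^sup>2 + b\<^sup>2 - 2 * (\<bar>a\<bar> * \<bar>b\<bar>)"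
      by (simp add: power2_diff)
    ultimately show ?thesis unfolding abs_mult by linarith
  qed
  then show "AE x in M. norm (f x * g x) \<le> norm ((f x)\<^sup>2 + (g x)\<^sup>2)"
    by (simp only: real_norm_def) simp
qed

lemma square_integrable_add:
  assumes "square_integrable M f" "square_integrable M g"
  shows "square_integrable M (\<lambda>x. f x + g x)"
  using assms square_integrable_mult[OF assms]
  by (auto simp: square_integrable_def power2_sum mult.assoc)

lemma square_integrable_cmult:
  "square_integrable M f \<Longrightarrow> square_integrable M (\<lambda>x. c * f x)"
  by (auto simp: square_integrable_def power_mult_distrib)

lemma square_integrable_diff:
  assumes "square_integrable M f" "square_integrable M g"
  shows "square_integrable M (\<lambda>x. f x - g x)"
  using square_integrable_add[OF assms(1) square_integrable_cmult[OF assms(2), of "-1"]] by simp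

lemma square_integrable_sum:
  "(\<And>i. i \<in> I \<Longrightarrow> square_integrable M (f i)) \<Longrightarrow> square_integrable M (\<lambda>x. \<Sum>i\<in>I. f i x)"
proof (induction I rule: infinite_finite_induct)
  case (insert i I)
  then show ?case by (simp add: square_integrable_add)
qed (simp_all add: square_integrable_def)

lemma integral_square_add:
  assumes "square_integrable M f" "square_integrable M g"
  shows "(\<integral>x. (f x + g x)\<^sup>2 \<partial>M) = (\<integral>x. (f x)\<^sup>2 \<partial>M) + (\<integral>x. (g x)\<^sup>2 \<partial>M) + 2 * (\<integral>x. f x * g x \<partial>M)"
  using assms square_integrable_mult[OF assms]
  by (simp add: square_integrable_def power2_sum mult.assoc)

lemma integral_square_diff:
  assumes "square_integrable M f" "square_integrable M g"
  shows "(\<integral>x. (f x - g x)\<^sup>2 \<partial>M) = (\<integral>x. (f x)\<^sup>2 \<partial>M) + (\<integral>x. (g x)\<^sup>2 \<partial>M) - 2 * (\<integral>x. f x * g x \<partial>M)"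
  using assms square_integrable_mult[OF assms]
  by (simp add: square_integrable_def power2_diff mult.assoc)

lemma Cauchy_Schwarz_integral:
  assumes f: "square_integrable M f" and g: "square_integrable M g"
  shows "\<bar>\<integral>x. f x * g x \<partial>M\<bar> \<le> sqrt ((\<integral>x. (f x)\<^sup>2 \<partial>M) * (\<integral>x. (g x)\<^sup>2 \<partial>M))"
proof -
  define a b c where "a = (\<integral>x. (f x)\<^sup>2 \<partial>M)" and "b = (\<integral>x. (g x)\<^sup>2 \<partial>M)"
    and "c = (\<integral>x. f x * g x \<partial>M)"
  have ab: "a \<ge> 0" "b \<ge> 0" by (auto simp: a_def b_def)
  have *: "0 \<le> t\<^sup>2 * a + b - 2 * (t * c)" for t
  proof -
    have "0 \<le> (\<integral>x. (t * f x - g x)\<^sup>2 \<partial>M)" by simp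
    also have "\<dots> = t\<^sup>2 * a + b - 2 * (t * c)"
      unfolding integral_square_diff[OF square_integrable_cmult[OF f] g]
      by (simp add: a_def b_def c_def power_mult_distrib mult.assoc)
    finally show ?thesis .
  qed
  have "c\<^sup>2 \<le> a * b"
  proof (cases "a = 0")
    case True
    have "c = 0"
    proof (rule ccontr)
      assume "c \<noteq> 0"
      with *[of "(b + 1) / (2 * c)"] True ab show False by (simp add: field_simps)
    qed
    then show ?thesis using ab by simp
  next
    case False
    with ab have "a > 0" by simp
    with *[of "c / a"] show ?thesis by (simp add: field_simps power2_eq_square)
  qed
  then show ?thesis
    unfolding a_def[symmetric] b_def[symmetric] c_def[symmetric]
    by (metis real_sqrt_abs real_sqrt_le_mono)
qed

lemma (in prob_space) square_integrable_integrable: "square_integrable M f \<Longrightarrow> integrable M f"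
  unfolding square_integrable_def by (blast intro: square_integrable_imp_integrable)

text \<open>Expanding the square of a sum with independent uniform signs kills all cross terms.\<close>

lemma sum_over_signs:
  fixes y :: "'i \<Rightarrow> real"
  assumes "finite I"
  shows "(\<Sum>T\<in>Pow I. ((\<Sum>i\<in>T. y i) - (\<Sum>i\<in>I - T. y i))\<^sup>2) = 2 ^ card I * (\<Sum>i\<in>I. (y i)\<^sup>2)"
  using assms
proof (induction I)
  case empty
  then show ?case by simp
next
  case (insert x F)
  let ?D = "\<lambda>T. (\<Sum>i\<in>T. y i) - (\<Sum>i\<in>F - T. y i)"
  let ?E = "\<lambda>T. (\<Sum>i\<in>T. y i) - (\<Sum>i\<in>insert x F - T. y i)"
  have out: "?E T = ?D T - y x" if "T \<in> Pow F" for T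
  proof -
    have "insert x F - T = insert x (F - T)" using that insert by auto
    then show ?thesis using insert by simp
  qed
  have inn: "?E (insert x T) = ?D T + y x" if "T \<in> Pow F" for T
  proof -
    have "insert x F - insert x T = F - T" "x \<notin> T" "finite T"
      using that insert by (auto intro: finite_subset)
    then show ?thesis by simp
  qed
  have "(\<Sum>T\<in>Pow (insert x F). (?E T)\<^sup>2)
      = (\<Sum>T\<in>Pow F. (?E T)\<^sup>2) + (\<Sum>T\<in>insert x ` Pow F. (?E T)\<^sup>2)"
    unfolding Pow_insert using insert by (intro sum.union_disjoint) auto
  also have "(\<Sum>T\<in>insert x ` Pow F. (?E T)\<^sup>2) = (\<Sum>T\<in>Pow F. (?E (insert x T))\<^sup>2)"
    using insert by (subst sum.reindex) (auto simp: inj_on_def o_def)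
  also have "(\<Sum>T\<in>Pow F. (?E T)\<^sup>2) + (\<Sum>T\<in>Pow F. (?E (insert x T))\<^sup>2)
      = (\<Sum>T\<in>Pow F. (?D T - y x)\<^sup>2 + (?D T + y x)\<^sup>2)"
    by (simp only: sum.distrib inn out cong: sum.cong)
  also have "\<dots> = (\<Sum>T\<in>Pow F. 2 * (?D T)\<^sup>2 + 2 * (y x)\<^sup>2)"
    by (intro sum.cong refl) (simp add: power2_eq_square algebra_simps)
  also have "\<dots> = 2 * (\<Sum>T\<in>Pow F. (?D T)\<^sup>2) + 2 ^ card F * (2 * (y x)\<^sup>2)"
    using insert.hyps by (simp add: sum.distrib sum_distrib_left[symmetric] card_Pow)
  finally show ?case
    unfolding insert.IH using insert.hyps by (simp add: distrib_left)
qed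

text \<open>
  For a sign pattern that is positive exactly on \<open>T\<close>, the signed and the unsigned sum differ only
  in the sign of the covariance of the two partial sums, which the hypothesis controls. So their
  second moments agree up to the factor \<open>(1 + r) / (1 - r)\<close>, and averaging over \<open>T\<close> removes the
  covariances from the signed side.
\<close>

lemma interlaced_second_moment:
  fixes Y :: "'i \<Rightarrow> 'a \<Rightarrow> real"
  assumes fin: "finite I" and Y: "\<And>i. i \<in> I \<Longrightarrow> square_integrable M (Y i)" and r: "0 \<le> r"
    and corr: "\<And>T. T \<subseteq> I \<Longrightarrow> \<bar>\<integral>x. (\<Sum>i\<in>T. Y i x) * (\<Sum>i\<in>I - T. Y i x) \<partial>M\<bar>
      \<le> r * sqrt ((\<integral>x. (\<Sum>i\<in>T. Y i x)\<^sup>2 \<partial>M) * (\<integral>x. (\<Sum>i\<in>I - T. Y i x)\<^sup>2 \<partial>M))"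
  shows "(1 - r) * (\<integral>x. (\<Sum>i\<in>I. Y i x)\<^sup>2 \<partial>M) \<le> (1 + r) * (\<Sum>i\<in>I. \<integral>x. (Y i x)\<^sup>2 \<partial>M)"
    and "(1 - r) * (\<Sum>i\<in>I. \<integral>x. (Y i x)\<^sup>2 \<partial>M) \<le> (1 + r) * (\<integral>x. (\<Sum>i\<in>I. Y i x)\<^sup>2 \<partial>M)"
proof -
  let ?W = "\<integral>x. (\<Sum>i\<in>I. Y i x)\<^sup>2 \<partial>M"
  let ?D = "\<lambda>T. \<integral>x. ((\<Sum>i\<in>T. Y i x) - (\<Sum>i\<in>I - T. Y i x))\<^sup>2 \<partial>M"
  have si: "square_integrable M (\<lambda>x. \<Sum>i\<in>T. Y i x)" if "T \<subseteq> I" for T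
    using that Y by (intro square_integrable_sum) auto
  have one: "(1 - r) * ?W \<le> (1 + r) * ?D T \<and> (1 - r) * ?D T \<le> (1 + r) * ?W"
    if T: "T \<in> Pow I" for T
  proof -
    let ?A = "\<lambda>x. \<Sum>i\<in>T. Y i x" and ?B = "\<lambda>x. \<Sum>i\<in>I - T. Y i x"
    have A: "square_integrable M ?A" and B: "square_integrable M ?B"
      using T by (auto intro!: si)
    define P Q c where "P = (\<integral>x. (?A x)\<^sup>2 \<partial>M)" and "Q = (\<integral>x. (?B x)\<^sup>2 \<partial>M)"
      and "c = (\<integral>x. ?A x * ?B x \<partial>M)"
    have "(\<Sum>i\<in>I. Y i x) = ?A x + ?B x" for x
      using T fin by (subst sum.subset_diff[of T I]) auto
    then have W: "?W = P + Q + 2 * c"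
      by (simp add: integral_square_add[OF A B] P_def Q_def c_def)
    have D: "?D T = P + Q - 2 * c"
      by (simp add: integral_square_diff[OF A B] P_def Q_def c_def)
    have "\<bar>c\<bar> \<le> r * sqrt (P * Q)"
      using corr[of T] T by (simp add: P_def Q_def c_def)
    also have "\<dots> \<le> r * ((P + Q) / 2)"
      using r by (intro mult_left_mono arith_geo_mean_sqrt) (auto simp: P_def Q_def)
    finally have "2 * \<bar>c\<bar> \<le> r * (P + Q)" by simp
    then show ?thesis unfolding W D by (auto simp: algebra_simps)
  qed
  have avg: "(\<Sum>T\<in>Pow I. ?D T) = 2 ^ card I * (\<Sum>i\<in>I. \<integral>x. (Y i x)\<^sup>2 \<partial>M)"
  proof -
    have int: "integrable M (\<lambda>x. ((\<Sum>i\<in>T. Y i x) - (\<Sum>i\<in>I - T. Y i x))\<^sup>2)" if "T \<in> Pow I" for T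
      using square_integrable_diff[OF si[of T] si[of "I - T"]] that
      by (auto simp: square_integrable_def)
    have "(\<Sum>T\<in>Pow I. ?D T) = (\<integral>x. (\<Sum>T\<in>Pow I. ((\<Sum>i\<in>T. Y i x) - (\<Sum>i\<in>I - T. Y i x))\<^sup>2) \<partial>M)"
      using int by (subst Bochner_Integration.integral_sum) auto
    also have "\<dots> = (\<integral>x. 2 ^ card I * (\<Sum>i\<in>I. (Y i x)\<^sup>2) \<partial>M)"
      using sum_over_signs[OF fin] by simp
    also have "\<dots> = 2 ^ card I * (\<Sum>i\<in>I. \<integral>x. (Y i x)\<^sup>2 \<partial>M)"
      using Y by (simp add: square_integrable_def)
    finally show ?thesis .
  qed
  have cW: "(\<Sum>T\<in>Pow I. c * ?W) = 2 ^ card I * (c * ?W)" for c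
    using fin by (simp add: card_Pow)
  have "(\<Sum>T\<in>Pow I. (1 - r) * ?W) \<le> (\<Sum>T\<in>Pow I. (1 + r) * ?D T)"
    using one by (intro sum_mono) blast
  then have "2 ^ card I * ((1 - r) * ?W) \<le> 2 ^ card I * ((1 + r) * (\<Sum>i\<in>I. \<integral>x. (Y i x)\<^sup>2 \<partial>M))"
    unfolding sum_distrib_left[symmetric, where r="1 + r"] avg cW by (simp only: ac_simps)
  then show "(1 - r) * ?W \<le> (1 + r) * (\<Sum>i\<in>I. \<integral>x. (Y i x)\<^sup>2 \<partial>M)" by simp
  have "(\<Sum>T\<in>Pow I. (1 - r) * ?D T) \<le> (\<Sum>T\<in>Pow I. (1 + r) * ?W)"
    using one by (intro sum_mono) blast
  then have "2 ^ card I * ((1 - r) * (\<Sum>i\<in>I. \<integral>x. (Y i x)\<^sup>2 \<partial>M)) \<le> 2 ^ card I * ((1 + r) * ?W)"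
    unfolding sum_distrib_left[symmetric, where r="1 - r"] avg cW by (simp only: ac_simps)
  then show "(1 - r) * (\<Sum>i\<in>I. \<integral>x. (Y i x)\<^sup>2 \<partial>M) \<le> (1 + r) * ?W" by simp
qed

section \<open>Boxes and blocks\<close>

definition lattice_box :: "nat ^ 'd \<Rightarrow> (int ^ 'd) set" where
  "lattice_box L = {k. \<forall>v. 1 \<le> k $ v \<and> k $ v \<le> int (L $ v)}"

text \<open>
  Slabs are additive in \<open>J\<close>, so cutting a box along direction \<open>u\<close> becomes a partition of the
  interval of positions.
\<close>

definition slab :: "nat ^ 'd \<Rightarrow> 'd \<Rightarrow> int set \<Rightarrow> (int ^ 'd) set" where
  "slab L u J = {k. k $ u \<in> J \<and> (\<forall>v. v \<noteq> u \<longrightarrow> 1 \<le> k $ v \<and> k $ v \<le> int (L $ v))}"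

definition resize :: "nat ^ 'd \<Rightarrow> 'd \<Rightarrow> nat \<Rightarrow> nat ^ 'd" where
  "resize L u p = (\<chi> v. if v = u then p else L $ v)"

definition cross :: "nat ^ 'd \<Rightarrow> 'd \<Rightarrow> real" where
  "cross L u = (\<Prod>v\<in>UNIV - {u}. real (L $ v))"

lemma box_eq_slab: "lattice_box L = slab L u {1..int (L $ u)}"
  unfolding lattice_box_def slab_def by auto

lemma resize_nth: "resize L u p $ v = (if v = u then p else L $ v)"
  by (simp add: resize_def)

lemma resize_same: "resize L u (L $ u) = L"
  by (simp add: resize_def vec_eq_iff)

lemma cross_resize: "cross (resize L u p) u = cross L u"
  unfolding cross_def by (intro prod.cong) (auto simp: resize_nth)

lemma slab_resize: "slab (resize L u p) u J = slab L u J"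
  unfolding slab_def by (auto simp: resize_nth)

lemma box_resize: "lattice_box (resize L u p) = slab L u {1..int p}"
  by (simp add: box_eq_slab[of _ u] slab_resize resize_nth)

lemma box_vol_cross: "box_vol L = real (L $ u) * cross L u"
  unfolding box_vol_def cross_def by (subst prod.remove[of _ u]) auto

lemma box_vol_resize: "box_vol (resize L u p) = real p * cross L u"
  by (simp add: box_vol_cross[of _ u] cross_resize resize_nth)

lemma cross_nonneg: "cross L u \<ge> 0"
  unfolding cross_def by (auto intro: prod_nonneg)

lemma box_vol_nonneg: "box_vol L \<ge> 0"
  unfolding box_vol_def by (auto intro: prod_nonneg)

lemma cross_pos: "(\<And>v. L $ v > 0) \<Longrightarrow> cross L u > 0"
  unfolding cross_def by (auto intro: prod_pos)

lemma box_vol_pos: "(\<And>v. L $ v > 0) \<Longrightarrow> box_vol L > 0"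
  unfolding box_vol_def by (auto intro: prod_pos)

lemma card_product_set:
  fixes F :: "'d::finite \<Rightarrow> 'b set"
  assumes "\<And>v. finite (F v)"
  shows "finite {k :: 'b ^ 'd. \<forall>v. k $ v \<in> F v}"
    and "card {k :: 'b ^ 'd. \<forall>v. k $ v \<in> F v} = (\<Prod>v\<in>UNIV. card (F v))"
proof -
  have eq: "{k :: 'b ^ 'd. \<forall>v. k $ v \<in> F v} = vec_lambda ` PiE UNIV F"
  proof (intro equalityI subsetI)
    fix k :: "'b ^ 'd" assume "k \<in> {k. \<forall>v. k $ v \<in> F v}"
    then have "vec_nth k \<in> PiE UNIV F" by auto
    moreover have "k = vec_lambda (vec_nth k)" by simp
    ultimately show "k \<in> vec_lambda ` PiE UNIV F" by blast
  qed auto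
  have inj: "inj_on (vec_lambda :: ('d \<Rightarrow> 'b) \<Rightarrow> _) (PiE UNIV F)"
    by (metis inj_onI vec_lambda_inverse UNIV_I)
  show "finite {k :: 'b ^ 'd. \<forall>v. k $ v \<in> F v}"
    unfolding eq using assms by (intro finite_imageI finite_PiE) auto
  show "card {k :: 'b ^ 'd. \<forall>v. k $ v \<in> F v} = (\<Prod>v\<in>UNIV. card (F v))"
    unfolding eq card_image[OF inj] by (simp add: card_PiE)
qed

lemma
  assumes "finite J"
  shows finite_slab: "finite (slab L u J)"
    and card_slab: "real (card (slab L u J)) = real (card J) * cross L u"
proof -
  let ?F = "\<lambda>v. if v = u then J else {1..int (L $ v)}"
  have eq: "slab L u J = {k. \<forall>v. k $ v \<in> ?F v}"
    unfolding slab_def by (auto split: if_splits)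
  have fin: "finite (?F v)" for v using assms by simp
  show "finite (slab L u J)" unfolding eq by (rule card_product_set) (rule fin)
  have "card (slab L u J) = (\<Prod>v\<in>UNIV. card (?F v))"
    unfolding eq by (rule card_product_set) (rule fin)
  also have "\<dots> = card J * (\<Prod>v\<in>UNIV - {u}. card (?F v))"
    by (subst prod.remove[of _ u]) auto
  also have "(\<Prod>v\<in>UNIV - {u}. card (?F v)) = (\<Prod>v\<in>UNIV - {u}. L $ v)"
    by (intro prod.cong) auto
  finally show "real (card (slab L u J)) = real (card J) * cross L u"
    by (simp add: cross_def)
qed

text \<open>Every box is a slab in each direction; \<open>undefined\<close> picks one of them.\<close>

lemma finite_box: "finite (lattice_box L)"
  unfolding box_eq_slab[of L undefined] by (rule finite_slab) simp

lemma card_box: "real (card (lattice_box L)) = box_vol L"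
  unfolding box_eq_slab[of L undefined] by (simp add: card_slab box_vol_cross[of L undefined])

lemma slab_UN: "slab L u (\<Union>i\<in>I. J i) = (\<Union>i\<in>I. slab L u (J i))"
  unfolding slab_def by auto

lemma slab_Un: "slab L u (J \<union> J') = slab L u J \<union> slab L u J'"
  unfolding slab_def by auto

lemma slab_disjoint: "J \<inter> J' = {} \<Longrightarrow> slab L u J \<inter> slab L u J' = {}"
  unfolding slab_def by auto

lemma slab_shift: "slab L u ((\<lambda>j. j + c) ` J) = (\<lambda>k. k + axis u c) ` slab L u J"
proof (intro equalityI subsetI)
  fix k assume k: "k \<in> slab L u ((\<lambda>j. j + c) ` J)"
  have "k - axis u c \<in> slab L u J"
    using k unfolding slab_def by (auto simp: axis_def)
  moreover have "k = (k - axis u c) + axis u c" by simp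
  ultimately show "k \<in> (\<lambda>k. k + axis u c) ` slab L u J" by blast
next
  fix k assume "k \<in> (\<lambda>k. k + axis u c) ` slab L u J"
  then show "k \<in> slab L u ((\<lambda>j. j + c) ` J)"
    unfolding slab_def by (auto simp: axis_def)
qed

text \<open>
  Block number \<open>i\<close> in a sequence of intervals of length \<open>p\<close> with gaps of length \<open>q\<close>. It is written
  as a translate of the first block so that stationarity applies to it directly.
\<close>

definition block :: "nat \<Rightarrow> nat \<Rightarrow> nat \<Rightarrow> int set" where
  "block p q i = (\<lambda>j. j + int (i * (p + q))) ` {1..int p}"

lemma block_iff: "j \<in> block p q i \<longleftrightarrow> int (i * (p + q)) < j \<and> j \<le> int (i * (p + q) + p)"
proof
  assume "int (i * (p + q)) < j \<and> j \<le> int (i * (p + q) + p)"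
  then have "j - int (i * (p + q)) \<in> {1..int p}" by auto
  then show "j \<in> block p q i" unfolding block_def by (intro image_eqI[of _ _ "j - int (i * (p + q))"]) auto
qed (auto simp: block_def)

lemma finite_block: "finite (block p q i)"
  by (simp add: block_def)

lemma card_block: "card (block p q i) = p"
  unfolding block_def by (subst card_image) (auto simp: inj_on_def)

lemma block_separated:
  assumes "i \<noteq> i'" "j \<in> block p q i" "j' \<in> block p q i'"
  shows "int q < \<bar>j - j'\<bar>"
proof -
  have *: "int q < b - a" if "i < i'" "a \<in> block p q i" "b \<in> block p q i'" for a b i i'
  proof -
    have "Suc i * (p + q) \<le> i' * (p + q)" using that by (intro mult_le_mono) auto
    then have "i * (p + q) + p + q \<le> i' * (p + q)" by simp
    then have "int (i * (p + q) + p + q) \<le> int (i' * (p + q))" by (simp only: of_nat_le_iff)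
    with that show ?thesis unfolding block_iff of_nat_add by linarith
  qed
  from assms(1) consider "i < i'" | "i' < i" by linarith
  then show ?thesis
    by cases (use *[of i i' j j'] *[of i' i j' j] assms in auto)
qed

lemma block_disjoint: "i \<noteq> i' \<Longrightarrow> block p q i \<inter> block p q i' = {}"
  using block_separated by fastforce

definition blocks :: "nat \<Rightarrow> nat \<Rightarrow> nat \<Rightarrow> int set" where
  "blocks p q m = (\<Union>i<m. block p q i)"

lemma finite_blocks: "finite (blocks p q m)"
  by (simp add: blocks_def finite_block)

lemma card_blocks: "card (blocks p q m) = m * p"
  unfolding blocks_def by (subst card_UN_disjoint) (auto simp: finite_block card_block block_disjoint)

text \<open>
  The summand \<open>q\<close> on the right accounts for the gap after the last block, which need not fit into
  the interval.
\<close>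

lemma blocks_subset:
  assumes "m * (p + q) \<le> N + q"
  shows "blocks p q m \<subseteq> {1..int N}"
proof
  fix j assume "j \<in> blocks p q m"
  then obtain i where i: "i < m" "j \<in> block p q i" by (auto simp: blocks_def)
  then have "Suc i * (p + q) \<le> m * (p + q)" by (intro mult_le_mono) auto
  with assms have "i * (p + q) + p \<le> N" by simp
  then have "int (i * (p + q) + p) \<le> int N" by (simp only: of_nat_le_iff)
  with i(2) show "j \<in> {1..int N}"
    unfolding block_iff atLeastAtMost_iff by linarith
qed

lemma card_rest:
  assumes "m * (p + q) \<le> N + q"
  shows "card ({1..int N} - blocks p q m) = N - m * p"
  using card_Diff_subset[OF finite_blocks blocks_subset[OF assms]] by (simp add: card_blocks)

section \<open>Second moments of sums\<close>

definition separated :: "'d \<Rightarrow> nat \<Rightarrow> (int ^ 'd) set \<Rightarrow> (int ^ 'd) set \<Rightarrow> bool" where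
  "separated u n Q R \<longleftrightarrow> (\<forall>k\<in>Q. \<forall>l\<in>R. int n \<le> \<bar>k $ u - l $ u\<bar>)"

definition field_sum :: "(int ^ 'd \<Rightarrow> 'a \<Rightarrow> real) \<Rightarrow> (int ^ 'd) set \<Rightarrow> 'a \<Rightarrow> real" where
  "field_sum Y Q \<omega> = (\<Sum>k\<in>Q. Y k \<omega>)"

text \<open>
  Only the laws of partial sums, and functions of two such sums, enter the argument. Isolating
  these consequences of stationarity and mixing allows the field and both parts of its truncation
  to be treated alike, with one and the same sequence \<open>r\<close>.
\<close>

locale sum_mixing = prob_space M
  for M :: "'a measure" +
  fixes Y :: "int ^ 'd \<Rightarrow> 'a \<Rightarrow> real" and r :: "nat \<Rightarrow> real"
  assumes Y_measurable [measurable]: "\<And>k. Y k \<in> borel_measurable M"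
    and Y_square: "integrable M (\<lambda>\<omega>. (Y 0 \<omega>)\<^sup>2)"
    and Y_mean: "expectation (Y 0) = 0"
    and shift: "\<And>Q h. finite Q \<Longrightarrow>
      distr M borel (\<lambda>\<omega>. \<Sum>k\<in>Q. Y (k + h) \<omega>) = distr M borel (\<lambda>\<omega>. \<Sum>k\<in>Q. Y k \<omega>)"
    and r_nonneg: "\<And>n. 0 \<le> r n"
    and r_tendsto: "r \<longlonglongrightarrow> 0"
    and mixing: "\<And>u n Q R \<phi> \<psi>. 1 \<le> n \<Longrightarrow> finite Q \<Longrightarrow> finite R \<Longrightarrow> separated u n Q R \<Longrightarrow>
      \<phi> \<in> borel_measurable borel \<Longrightarrow> \<psi> \<in> borel_measurable borel \<Longrightarrow>
      square_integrable M (\<lambda>\<omega>. \<phi> (field_sum Y Q \<omega>)) \<Longrightarrow>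
      square_integrable M (\<lambda>\<omega>. \<psi> (field_sum Y R \<omega>)) \<Longrightarrow>
      \<bar>expectation (\<lambda>\<omega>. \<phi> (field_sum Y Q \<omega>) * \<psi> (field_sum Y R \<omega>))
        - expectation (\<lambda>\<omega>. \<phi> (field_sum Y Q \<omega>)) * expectation (\<lambda>\<omega>. \<psi> (field_sum Y R \<omega>))\<bar>
      \<le> r n * sqrt (expectation (\<lambda>\<omega>. (\<phi> (field_sum Y Q \<omega>))\<^sup>2)
                   * expectation (\<lambda>\<omega>. (\<psi> (field_sum Y R \<omega>))\<^sup>2))"
begin

abbreviation "S \<equiv> field_sum Y"

lemma S_measurable [measurable]: "S Q \<in> borel_measurable M"
  unfolding field_sum_def[abs_def] by measurable

lemma distr_S_shift: "finite Q \<Longrightarrow> distr M borel (S ((\<lambda>k. k + h) ` Q)) = distr M borel (S Q)"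
  using shift[of Q h] by (simp add: field_sum_def[abs_def] sum.reindex)

lemma integrable_S_shift:
  fixes \<phi> :: "real \<Rightarrow> real"
  assumes "finite Q" "\<phi> \<in> borel_measurable borel"
  shows "integrable M (\<lambda>\<omega>. \<phi> (S ((\<lambda>k. k + h) ` Q) \<omega>)) \<longleftrightarrow> integrable M (\<lambda>\<omega>. \<phi> (S Q \<omega>))"
  using integrable_distr_eq[of "S Q" M borel \<phi>]
    integrable_distr_eq[of "S ((\<lambda>k. k + h) ` Q)" M borel \<phi>] assms
  by (simp add: distr_S_shift)

lemma expectation_S_shift:
  fixes \<phi> :: "real \<Rightarrow> real"
  assumes "finite Q" "\<phi> \<in> borel_measurable borel"
  shows "expectation (\<lambda>\<omega>. \<phi> (S ((\<lambda>k. k + h) ` Q) \<omega>)) = expectation (\<lambda>\<omega>. \<phi> (S Q \<omega>))"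
  using integral_distr[of "S Q" M borel \<phi>]
    integral_distr[of "S ((\<lambda>k. k + h) ` Q)" M borel \<phi>] assms
  by (simp add: distr_S_shift)

lemma S_singleton: "S {k} = Y k"
  by (simp add: field_sum_def[abs_def])

lemma S_empty: "S {} = (\<lambda>_. 0)"
  by (simp add: field_sum_def[abs_def])

lemma integrable_Y_iff:
  fixes \<phi> :: "real \<Rightarrow> real"
  assumes "\<phi> \<in> borel_measurable borel"
  shows "integrable M (\<lambda>\<omega>. \<phi> (Y k \<omega>)) \<longleftrightarrow> integrable M (\<lambda>\<omega>. \<phi> (Y 0 \<omega>))"
  using integrable_S_shift[of "{0}" \<phi> k, OF _ assms]
  by (simp only: finite.intros image_insert image_empty S_singleton add_0 simp_thms)

lemma expectation_Y:
  fixes \<phi> :: "real \<Rightarrow> real"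
  assumes "\<phi> \<in> borel_measurable borel"
  shows "expectation (\<lambda>\<omega>. \<phi> (Y k \<omega>)) = expectation (\<lambda>\<omega>. \<phi> (Y 0 \<omega>))"
  using expectation_S_shift[of "{0}" \<phi> k, OF _ assms]
  by (simp only: finite.intros image_insert image_empty S_singleton add_0 simp_thms)

lemma square_integrable_Y: "square_integrable M (Y k)"
  unfolding square_integrable_def
  by (subst integrable_Y_iff[of "\<lambda>x. x\<^sup>2" k]) (simp_all add: Y_square)

lemma expectation_Y_square: "expectation (\<lambda>\<omega>. (Y k \<omega>)\<^sup>2) = expectation (\<lambda>\<omega>. (Y 0 \<omega>)\<^sup>2)"
proof -
  have "(\<lambda>x::real. x\<^sup>2) \<in> borel_measurable borel" by simp
  from expectation_Y[OF this] show ?thesis .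
qed

lemma square_integrable_S: "square_integrable M (S Q)"
  unfolding field_sum_def[abs_def] by (intro square_integrable_sum square_integrable_Y)

lemma expectation_S: "expectation (S Q) = 0"
proof -
  have "expectation (Y k) = 0" for k using expectation_Y[of "\<lambda>x. x" k] Y_mean by simp
  then show ?thesis
    unfolding field_sum_def[abs_def] using square_integrable_integrable[OF square_integrable_Y] by simp
qed

lemma S_union_disjoint:
  assumes "finite I" "\<And>i. i \<in> I \<Longrightarrow> finite (Q i)"
    "\<And>i j. i \<in> I \<Longrightarrow> j \<in> I \<Longrightarrow> i \<noteq> j \<Longrightarrow> Q i \<inter> Q j = {}"
  shows "S (\<Union>i\<in>I. Q i) \<omega> = (\<Sum>i\<in>I. S (Q i) \<omega>)"
  unfolding field_sum_def using assms by (intro sum.UNION_disjoint) auto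

lemma separated_disjoint: "separated u n Q R \<Longrightarrow> 1 \<le> n \<Longrightarrow> Q \<inter> R = {}"
proof (rule ccontr)
  assume sep: "separated u n Q R" and n: "1 \<le> n" and "Q \<inter> R \<noteq> {}"
  then obtain k where "k \<in> Q" "k \<in> R" by blast
  with sep have "int n \<le> \<bar>k $ u - k $ u\<bar>" unfolding separated_def by blast
  with n show False by simp
qed

lemma covariance_separated:
  assumes "1 \<le> n" "finite Q" "finite R" "separated u n Q R"
  shows "\<bar>expectation (\<lambda>\<omega>. S Q \<omega> * S R \<omega>)\<bar>
    \<le> r n * sqrt (expectation (\<lambda>\<omega>. (S Q \<omega>)\<^sup>2) * expectation (\<lambda>\<omega>. (S R \<omega>)\<^sup>2))"
  using mixing[OF assms, of "\<lambda>x. x" "\<lambda>x. x"] square_integrable_S expectation_S by simp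

lemma separated_family_second_moment:
  assumes n: "1 \<le> n" and I: "finite I" and fin: "\<And>i. i \<in> I \<Longrightarrow> finite (Q i)"
    and sep: "\<And>i j. i \<in> I \<Longrightarrow> j \<in> I \<Longrightarrow> i \<noteq> j \<Longrightarrow> separated u n (Q i) (Q j)"
  shows "(1 - r n) * expectation (\<lambda>\<omega>. (S (\<Union>i\<in>I. Q i) \<omega>)\<^sup>2)
      \<le> (1 + r n) * (\<Sum>i\<in>I. expectation (\<lambda>\<omega>. (S (Q i) \<omega>)\<^sup>2))"
    and "(1 - r n) * (\<Sum>i\<in>I. expectation (\<lambda>\<omega>. (S (Q i) \<omega>)\<^sup>2))
      \<le> (1 + r n) * expectation (\<lambda>\<omega>. (S (\<Union>i\<in>I. Q i) \<omega>)\<^sup>2)"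
proof -
  have un: "(\<Sum>i\<in>T. S (Q i) \<omega>) = S (\<Union>i\<in>T. Q i) \<omega>" if "T \<subseteq> I" for T \<omega>
  proof (rule S_union_disjoint[symmetric])
    show "finite T" using that I by (rule finite_subset)
    show "finite (Q i)" if "i \<in> T" for i using that \<open>T \<subseteq> I\<close> fin by blast
    show "Q i \<inter> Q j = {}" if "i \<in> T" "j \<in> T" "i \<noteq> j" for i j
      using that \<open>T \<subseteq> I\<close> by (intro separated_disjoint[OF sep n]) auto
  qed
  have corr: "\<bar>expectation (\<lambda>\<omega>. (\<Sum>i\<in>T. S (Q i) \<omega>) * (\<Sum>i\<in>I - T. S (Q i) \<omega>))\<bar>
      \<le> r n * sqrt (expectation (\<lambda>\<omega>. (\<Sum>i\<in>T. S (Q i) \<omega>)\<^sup>2)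
                   * expectation (\<lambda>\<omega>. (\<Sum>i\<in>I - T. S (Q i) \<omega>)\<^sup>2))"
    if T: "T \<subseteq> I" for T
  proof -
    have "separated u n (\<Union>i\<in>T. Q i) (\<Union>i\<in>I - T. Q i)"
      using T sep unfolding separated_def by blast
    moreover have "finite (\<Union>i\<in>T. Q i)" "finite (\<Union>i\<in>I - T. Q i)"
      using T I fin finite_subset[OF T I] by auto
    ultimately have "\<bar>expectation (\<lambda>\<omega>. S (\<Union>i\<in>T. Q i) \<omega> * S (\<Union>i\<in>I - T. Q i) \<omega>)\<bar>
      \<le> r n * sqrt (expectation (\<lambda>\<omega>. (S (\<Union>i\<in>T. Q i) \<omega>)\<^sup>2)
                   * expectation (\<lambda>\<omega>. (S (\<Union>i\<in>I - T. Q i) \<omega>)\<^sup>2))"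
      by (intro covariance_separated[OF n])
    then show ?thesis by (simp only: un[OF T] un[OF Diff_subset])
  qed
  note * = interlaced_second_moment[OF I square_integrable_S r_nonneg corr]
  show "(1 - r n) * expectation (\<lambda>\<omega>. (S (\<Union>i\<in>I. Q i) \<omega>)\<^sup>2)
      \<le> (1 + r n) * (\<Sum>i\<in>I. expectation (\<lambda>\<omega>. (S (Q i) \<omega>)\<^sup>2))"
    using *(1) by (simp only: un[OF subset_refl])
  show "(1 - r n) * (\<Sum>i\<in>I. expectation (\<lambda>\<omega>. (S (Q i) \<omega>)\<^sup>2))
      \<le> (1 + r n) * expectation (\<lambda>\<omega>. (S (\<Union>i\<in>I. Q i) \<omega>)\<^sup>2)"
    using *(2) by (simp only: un[OF subset_refl])
qed

lemma square_sum_le: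
  assumes "finite I" "\<And>i. i \<in> I \<Longrightarrow> square_integrable M (f i)"
  shows "expectation (\<lambda>\<omega>. (\<Sum>i\<in>I. f i \<omega>)\<^sup>2) \<le> card I * (\<Sum>i\<in>I. expectation (\<lambda>\<omega>. (f i \<omega>)\<^sup>2))"
proof -
  have "expectation (\<lambda>\<omega>. (\<Sum>i\<in>I. f i \<omega>)\<^sup>2) \<le> expectation (\<lambda>\<omega>. card I * (\<Sum>i\<in>I. (f i \<omega>)\<^sup>2))"
  proof (rule integral_mono)
    show "integrable M (\<lambda>\<omega>. (\<Sum>i\<in>I. f i \<omega>)\<^sup>2)"
      using square_integrable_sum[of I M f] assms by (simp add: square_integrable_def)
    show "integrable M (\<lambda>\<omega>. card I * (\<Sum>i\<in>I. (f i \<omega>)\<^sup>2))"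
      using assms by (simp add: square_integrable_def)
    show "(\<Sum>i\<in>I. f i \<omega>)\<^sup>2 \<le> card I * (\<Sum>i\<in>I. (f i \<omega>)\<^sup>2)" for \<omega>
      using sum_squared_le_sum_of_squares[of "\<lambda>i. f i \<omega>" I] by (simp add: mult.commute)
  qed
  also have "\<dots> = card I * (\<Sum>i\<in>I. expectation (\<lambda>\<omega>. (f i \<omega>)\<^sup>2))"
    using assms by (simp add: square_integrable_def)
  finally show ?thesis .
qed

text \<open>
  Induction on the set \<open>U\<close> of coordinates that vary within \<open>Q\<close>. Along a new coordinate \<open>u\<close> the slices
  with the same residue modulo \<open>n\<close> are at distance at least \<open>n\<close> from each other, so the sign argument
  bounds each residue class by three times the sum of its slices; recombining the \<open>n\<close> classes costs
  a factor \<open>n\<close> by the Cauchy--Schwarz inequality.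
\<close>

lemma second_moment_bound_fixed_coordinates:
  assumes n: "1 \<le> n" "r n \<le> 1 / 2" and "finite U"
  shows "\<And>Q c. finite Q \<Longrightarrow> (\<And>k v. k \<in> Q \<Longrightarrow> v \<notin> U \<Longrightarrow> k $ v = c v) \<Longrightarrow>
    expectation (\<lambda>\<omega>. (S Q \<omega>)\<^sup>2) \<le> real (3 * n) ^ card U * card Q * expectation (\<lambda>\<omega>. (Y 0 \<omega>)\<^sup>2)"
  using \<open>finite U\<close>
proof (induction U)
  case empty
  show ?case
  proof (cases "Q = {}")
    case False
    then obtain k where k: "k \<in> Q" by auto
    have "l = k" if "l \<in> Q" for l
    proof -
      have "l $ v = k $ v" for v
        using empty(2)[OF that, of v] empty(2)[OF k, of v] by simp
      then show ?thesis by (simp only: vec_eq_iff) simp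
    qed
    with k have "Q = {k}" by blast
    then show ?thesis
      by (simp add: S_singleton expectation_Y_square[of k])
  qed (simp add: S_empty)
next
  case (insert u U)
  define C where "C = real (3 * n) ^ card U * expectation (\<lambda>\<omega>. (Y 0 \<omega>)\<^sup>2)"
  define J where "J a = {j \<in> (\<lambda>k. k $ u) ` Q. j mod int n = a}" for a
  define P where "P j = {k \<in> Q. k $ u = j}" for j
  have finJ: "finite (J a)" and finP: "finite (P j)" for a j
    using insert.prems(1) by (auto simp: J_def P_def)
  have IH: "expectation (\<lambda>\<omega>. (S (P j) \<omega>)\<^sup>2) \<le> C * card (P j)" for j
  proof -
    have "expectation (\<lambda>\<omega>. (S (P j) \<omega>)\<^sup>2)
        \<le> real (3 * n) ^ card U * card (P j) * expectation (\<lambda>\<omega>. (Y 0 \<omega>)\<^sup>2)"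
    proof (rule insert.IH[of "P j" "c(u := j)"])
      show "finite (P j)" by (rule finP)
      fix k v assume k: "k \<in> P j" and v: "v \<notin> U"
      show "k $ v = (c(u := j)) v"
        using k v insert.prems(2)[of k v] by (cases "v = u") (simp_all add: P_def)
    qed
    then show ?thesis by (simp add: C_def ac_simps)
  qed
  let ?R = "\<lambda>a. \<Union>j\<in>J a. P j"
  have part: "expectation (\<lambda>\<omega>. (S (?R a) \<omega>)\<^sup>2) \<le> 3 * C * card (?R a)" for a
  proof -
    have sep: "separated u n (P i) (P j)" if "i \<in> J a" "j \<in> J a" "i \<noteq> j" for i j
    proof -
      have "i mod int n = j mod int n" using that by (simp add: J_def)
      then have "int n dvd i - j" by (simp only: mod_eq_dvd_iff)
      then have "int n \<le> \<bar>i - j\<bar>" using \<open>i \<noteq> j\<close> dvd_imp_le_int[of "i - j" "int n"] by auto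
      then show ?thesis by (auto simp: separated_def P_def)
    qed
    have "(1 - r n) * expectation (\<lambda>\<omega>. (S (?R a) \<omega>)\<^sup>2)
        \<le> (1 + r n) * (\<Sum>j\<in>J a. expectation (\<lambda>\<omega>. (S (P j) \<omega>)\<^sup>2))"
      by (intro separated_family_second_moment[OF n(1), where u = u] finJ finP sep)
    moreover have "1 / 2 * expectation (\<lambda>\<omega>. (S (?R a) \<omega>)\<^sup>2)
        \<le> (1 - r n) * expectation (\<lambda>\<omega>. (S (?R a) \<omega>)\<^sup>2)"
      using n by (intro mult_right_mono) auto
    moreover have "(1 + r n) * (\<Sum>j\<in>J a. expectation (\<lambda>\<omega>. (S (P j) \<omega>)\<^sup>2))
        \<le> 3 / 2 * (\<Sum>j\<in>J a. expectation (\<lambda>\<omega>. (S (P j) \<omega>)\<^sup>2))"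
      using n by (intro mult_right_mono sum_nonneg) auto
    moreover have "(\<Sum>j\<in>J a. expectation (\<lambda>\<omega>. (S (P j) \<omega>)\<^sup>2)) \<le> (\<Sum>j\<in>J a. C * card (P j))"
      by (intro sum_mono IH)
    moreover have "(\<Sum>j\<in>J a. C * card (P j)) = C * card (?R a)"
      by (subst card_UN_disjoint) (auto simp: finJ finP sum_distrib_left, auto simp: P_def)
    ultimately show ?thesis by linarith
  qed
  have Q: "Q = (\<Union>a\<in>{0..<int n}. ?R a)"
    using n(1) by (auto simp: J_def P_def)
  have disj: "?R a \<inter> ?R b = {}" if "a \<noteq> b" for a b
    using that by (auto simp: J_def P_def)
  have finR: "finite (?R a)" for a
    using finJ finP by auto
  have "S Q \<omega> = (\<Sum>a\<in>{0..<int n}. S (?R a) \<omega>)" for \<omega>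
    by (subst Q, rule S_union_disjoint) (use disj finR in auto)
  then have "expectation (\<lambda>\<omega>. (S Q \<omega>)\<^sup>2) = expectation (\<lambda>\<omega>. (\<Sum>a\<in>{0..<int n}. S (?R a) \<omega>)\<^sup>2)"
    by simp
  also have "\<dots> \<le> n * (\<Sum>a\<in>{0..<int n}. expectation (\<lambda>\<omega>. (S (?R a) \<omega>)\<^sup>2))"
    using square_sum_le[of "{0..<int n}" "\<lambda>a. S (?R a)"] square_integrable_S by simp
  also have "\<dots> \<le> n * (\<Sum>a\<in>{0..<int n}. 3 * C * card (?R a))"
    by (intro mult_left_mono sum_mono part) auto
  also have "(\<Sum>a\<in>{0..<int n}. 3 * C * card (?R a)) = 3 * C * card Q"
  proof -
    have "card Q = (\<Sum>a\<in>{0..<int n}. card (?R a))"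
      using card_UN_disjoint[of "{0..<int n}" ?R] finR disj unfolding Q[symmetric] by simp
    then show ?thesis by (simp add: sum_distrib_left)
  qed
  finally show ?case
    using insert.hyps by (simp add: C_def ac_simps)
qed

text \<open>
  The constant depends on the mixing sequence and the dimension alone. The truncation argument
  needs this, because there the bound is applied to fields that vary with the truncation level.
\<close>

lemma second_moment_bound:
  assumes "1 \<le> n" "r n \<le> 1 / 2" "finite Q"
  shows "expectation (\<lambda>\<omega>. (S Q \<omega>)\<^sup>2)
    \<le> real (3 * n) ^ CARD('d) * card Q * expectation (\<lambda>\<omega>. (Y 0 \<omega>)\<^sup>2)"
  using second_moment_bound_fixed_coordinates[OF assms(1,2), of UNIV Q] assms(3) by simp

lemma r_small: "\<epsilon> > 0 \<Longrightarrow> \<exists>n\<ge>1. r n \<le> \<epsilon>"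
proof -
  assume "\<epsilon> > 0"
  then have "\<forall>\<^sub>F n in sequentially. r n < \<epsilon>" using r_tendsto by (intro order_tendstoD) auto
  then have "\<forall>\<^sub>F n in sequentially. 1 \<le> n \<and> r n < \<epsilon>"
    using eventually_ge_at_top[of 1] by eventually_elim auto
  then show ?thesis
    by (auto simp: eventually_sequentially intro: less_imp_le)
qed

end

section \<open>The limiting variance\<close>

lemma eventually_min_at_top:
  "eventually P (min_at_top :: (nat ^ 'd) filter) \<longleftrightarrow> (\<exists>N. \<forall>L. (\<forall>v. N \<le> L $ v) \<longrightarrow> P L)"
proof -
  have Min: "N \<le> (MIN u. L $ u) \<longleftrightarrow> (\<forall>v. N \<le> L $ v)" for L :: "nat ^ 'd" and N
    by (subst Min_ge_iff) auto
  show ?thesis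
    unfolding min_at_top_def eventually_filtercomap eventually_at_top_linorder
  proof safe
    fix Q N assume "\<forall>x. Q (MIN u. x $ u) \<longrightarrow> P x" "\<forall>n\<ge>N. Q n"
    then show "\<exists>N. \<forall>L. (\<forall>v. N \<le> L $ v) \<longrightarrow> P L"
      unfolding Min[symmetric] by blast
  next
    fix N assume "\<forall>L. (\<forall>v. N \<le> L $ v) \<longrightarrow> P L"
    then show "\<exists>Q. (\<exists>N. \<forall>n\<ge>N. Q n) \<and> (\<forall>x. Q (MIN u. x $ u) \<longrightarrow> P x)"
      unfolding Min[symmetric] by (intro exI[of _ "\<lambda>n. N \<le> n"]) auto
  qed
qed

lemma separated_slab_blocks:
  "i \<noteq> j \<Longrightarrow> separated u q (slab L u (block p q i)) (slab L u (block p q j))"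
  unfolding separated_def slab_def using block_separated by (fastforce intro: less_imp_le)

context sum_mixing
begin

lemma second_moment_le_card:
  obtains K where "K > 0" "\<And>Q. finite Q \<Longrightarrow> expectation (\<lambda>\<omega>. (S Q \<omega>)\<^sup>2) \<le> K * real (card Q)"
proof -
  obtain n where n: "1 \<le> n" "r n \<le> 1 / 2" using r_small[of "1 / 2"] by auto
  let ?K = "real (3 * n) ^ CARD('d) * expectation (\<lambda>\<omega>. (Y 0 \<omega>)\<^sup>2) + 1"
  show ?thesis
  proof (rule that[of ?K])
    show "?K > 0" by (intro add_nonneg_pos mult_nonneg_nonneg) auto
    fix Q :: "(int ^ 'd) set" assume "finite Q"
    then have "expectation (\<lambda>\<omega>. (S Q \<omega>)\<^sup>2) \<le> (?K - 1) * card Q"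
      using second_moment_bound[OF n, of Q] by (simp add: ac_simps)
    also have "\<dots> \<le> ?K * real (card Q)" by (intro mult_right_mono) auto
    finally show "expectation (\<lambda>\<omega>. (S Q \<omega>)\<^sup>2) \<le> ?K * real (card Q)" .
  qed
qed

lemma S_box_split:
  assumes "m * (p + q) \<le> L $ u + q"
  shows "S (lattice_box L) \<omega> = S (slab L u (blocks p q m)) \<omega>
    + S (slab L u ({1..int (L $ u)} - blocks p q m)) \<omega>"
proof -
  have "lattice_box L = slab L u (blocks p q m) \<union> slab L u ({1..int (L $ u)} - blocks p q m)"
    unfolding box_eq_slab[of L u] slab_Un[symmetric] using blocks_subset[OF assms]
    by (intro arg_cong[where f = "slab L u"]) auto
  then show ?thesis
    unfolding field_sum_def
    by (simp only:) (intro sum.union_disjoint finite_slab finite_blocks slab_disjoint, auto)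
qed

lemma distr_S_block: "distr M borel (S (slab L u (block p q i))) = distr M borel (S (lattice_box (resize L u p)))"
  unfolding block_def slab_shift box_resize by (intro distr_S_shift finite_slab) simp

lemma expectation_S_block:
  fixes \<phi> :: "real \<Rightarrow> real"
  assumes "\<phi> \<in> borel_measurable borel"
  shows "expectation (\<lambda>\<omega>. \<phi> (S (slab L u (block p q i)) \<omega>)) = expectation (\<lambda>\<omega>. \<phi> (S (lattice_box (resize L u p)) \<omega>))"
  unfolding block_def slab_shift box_resize by (intro expectation_S_shift finite_slab assms) simp

lemma second_moment_blocks:
  fixes L u p q
  defines "v \<equiv> expectation (\<lambda>\<omega>. (S (lattice_box (resize L u p)) \<omega>)\<^sup>2)"
  assumes "1 \<le> q"
  shows "\<bar>expectation (\<lambda>\<omega>. (S (slab L u (blocks p q m)) \<omega>)\<^sup>2) - m * v\<bar>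
    \<le> r q * (expectation (\<lambda>\<omega>. (S (slab L u (blocks p q m)) \<omega>)\<^sup>2) + m * v)"
proof -
  let ?Q = "\<lambda>i. slab L u (block p q i)"
  have v: "expectation (\<lambda>\<omega>. (S (?Q i) \<omega>)\<^sup>2) = v" for i
    unfolding v_def by (rule expectation_S_block) measurable
  have Q: "slab L u (blocks p q m) = (\<Union>i\<in>{..<m}. ?Q i)"
    unfolding blocks_def slab_UN ..
  note * = separated_family_second_moment[OF assms(2), of "{..<m}" ?Q u,
      OF _ finite_slab[OF finite_block] separated_slab_blocks, unfolded v Q[symmetric]]
  from *(1) *(2) show ?thesis by (simp add: abs_le_iff algebra_simps)
qed

text \<open>
  Here \<open>D\<close> is the fraction of positions in direction \<open>u\<close> that no block covers. The discarded part has
  a second moment of order \<open>D\<close> times the volume and, through the cross term, perturbs the total at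
  order \<open>sqrt D\<close>; the correlation between the blocks accounts for the term with \<open>r q\<close>.
\<close>

lemma second_moment_compare:
  fixes L :: "nat ^ 'd" and u p q m
  defines "D \<equiv> real (L $ u - m * p) / real (L $ u)"
    and "v \<equiv> expectation (\<lambda>\<omega>. (S (lattice_box (resize L u p)) \<omega>)\<^sup>2)"
  assumes K: "K > 0" "\<And>Q. finite Q \<Longrightarrow> expectation (\<lambda>\<omega>. (S Q \<omega>)\<^sup>2) \<le> K * real (card Q)"
    and L: "\<And>v. L $ v > 0" and pq: "1 \<le> p" "1 \<le> q" and m: "m * (p + q) \<le> L $ u + q"
  shows "\<bar>expectation (\<lambda>\<omega>. (S (lattice_box L) \<omega>)\<^sup>2) / box_vol L - v / box_vol (resize L u p)\<bar>
    \<le> K * (4 * sqrt D + 2 * r q)"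
proof -
  define B R where "B = slab L u (blocks p q m)" and "R = slab L u ({1..int (L $ u)} - blocks p q m)"
  define c N where "c = cross L u" and "N = real (L $ u)"
  define a e x where "a = expectation (\<lambda>\<omega>. (S B \<omega>)\<^sup>2)" and "e = expectation (\<lambda>\<omega>. (S R \<omega>)\<^sup>2)"
    and "x = expectation (\<lambda>\<omega>. S B \<omega> * S R \<omega>)"
  have c: "c > 0" unfolding c_def by (rule cross_pos) (rule L)
  have N: "N > 0" unfolding N_def using L[of u] by simp
  have "m * p \<le> L $ u"
  proof (cases m)
    case (Suc k)
    then have "q + m * p \<le> m * (p + q)" by (simp add: algebra_simps)
    with m show ?thesis by linarith
  qed simp
  then have mp: "real m * p \<le> N" by (simp add: N_def flip: of_nat_mult)
  have D: "D = (N - m * p) / N"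
    using \<open>m * p \<le> L $ u\<close> by (simp add: D_def N_def of_nat_diff)
  have D01: "0 \<le> D" "D \<le> 1" using N mp by (auto simp: D)
  have vol: "box_vol L = N * c" "box_vol (resize L u p) = p * c"
    by (simp_all add: box_vol_cross[of L u] box_vol_resize N_def c_def)
  have nonneg: "a \<ge> 0" "e \<ge> 0" "v \<ge> 0" by (auto simp: a_def e_def v_def)
  have v: "v \<le> K * (p * c)"
    using K(2)[OF finite_box, of "resize L u p"] unfolding card_box vol v_def .
  have a: "a \<le> K * (m * p * c)"
    using K(2)[of B] by (simp add: a_def B_def finite_slab card_slab finite_blocks card_blocks c_def ac_simps)
  then have a': "a \<le> K * (N * c)"
    by (rule order_trans) (use K(1) c mp in auto)
  have e: "e \<le> K * (N * c) * D"
  proof -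
    have "e \<le> K * real (card R)"
      unfolding e_def R_def by (intro K(2) finite_slab) simp
    also have "real (card R) = (N * D) * c"
      using N \<open>m * p \<le> L $ u\<close>
      by (simp add: R_def card_slab card_rest[OF m] c_def D) (simp add: N_def of_nat_diff)
    finally show ?thesis by (simp add: ac_simps)
  qed
  have tot: "expectation (\<lambda>\<omega>. (S (lattice_box L) \<omega>)\<^sup>2) = a + e + 2 * x"
    unfolding S_box_split[OF m] a_def e_def x_def B_def R_def
    by (intro integral_square_add square_integrable_S)
  have "\<bar>x\<bar> \<le> sqrt (a * e)"
    unfolding x_def a_def e_def by (intro Cauchy_Schwarz_integral square_integrable_S)
  also have "\<dots> \<le> sqrt ((K * (N * c))\<^sup>2 * D)"
    using nonneg mult_mono[OF a' e] K c N by (simp add: power2_eq_square mult.assoc)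
  also have "\<dots> = K * (N * c) * sqrt D"
    using K c N by (simp add: real_sqrt_mult)
  finally have x: "\<bar>x\<bar> \<le> K * (N * c) * sqrt D" .
  have "D\<^sup>2 \<le> D" using D01 by (simp add: power2_eq_square mult_left_le)
  then have "D \<le> sqrt D" by (rule real_le_rsqrt)
  then have D_sqrt: "K * (N * c) * D \<le> K * (N * c) * sqrt D"
    using K c N by (intro mult_left_mono) auto
  have "\<bar>a - m * v\<bar> \<le> r q * (a + m * v)"
    unfolding a_def v_def B_def by (rule second_moment_blocks) (rule pq)
  also have "\<dots> \<le> r q * (2 * (K * (N * c)))"
  proof (intro mult_left_mono r_nonneg)
    have "m * v \<le> m * (K * (p * c))" using v by (intro mult_left_mono) auto
    also have "\<dots> = (K * c) * (real m * p)" by simp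
    also have "\<dots> \<le> (K * c) * N" using mp K c by (intro mult_left_mono) auto
    finally show "a + m * v \<le> 2 * (K * (N * c))" using a' by (simp add: ac_simps)
  qed
  finally have av: "\<bar>a - m * v\<bar> \<le> r q * (2 * (K * (N * c)))" .
  have "N * v / p - m * v = (N * D) * (v / p)"
    using N pq by (simp add: D field_simps)
  moreover have "(N * D) * (v / p) \<le> (N * D) * (K * c)"
    using v N D01 pq by (intro mult_left_mono) (auto simp: field_simps)
  moreover have "0 \<le> (N * D) * (v / p)"
    using N D01 nonneg by simp
  ultimately have mv: "\<bar>m * v - N * v / p\<bar> \<le> K * (N * c) * D"
    by (simp add: abs_if ac_simps)
  have "\<bar>a + e + 2 * x - N * v / p\<bar> \<le> K * (N * c) * (4 * sqrt D + 2 * r q)"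
    using x av mv e D_sqrt nonneg by (simp add: algebra_simps)
  moreover have "expectation (\<lambda>\<omega>. (S (lattice_box L) \<omega>)\<^sup>2) / box_vol L - v / box_vol (resize L u p)
      = (a + e + 2 * x - N * v / p) / (N * c)"
    using N c pq by (simp add: tot vol field_simps)
  moreover have "0 < N * c" using N c by simp
  ultimately show ?thesis
    by (simp only: abs_divide abs_of_pos pos_divide_le_eq) (simp only: ac_simps)
qed

text \<open>
  Choose the gap \<open>q\<close> first, to make the correlation small, then \<open>p\<close> much larger than \<open>q\<close>, then the side
  much larger than \<open>p\<close>. It is essential for the next lemma that \<open>p\<close> and \<open>N0\<close> do not depend on the
  remaining sides of the box.
\<close>

lemma normalized_variance_stable:
  assumes "\<epsilon> > 0"
  obtains p N0 where "1 \<le> p"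
    "\<And>L u. (\<And>v. L $ v > 0) \<Longrightarrow> N0 \<le> L $ u \<Longrightarrow>
      \<bar>expectation (\<lambda>\<omega>. (S (lattice_box L) \<omega>)\<^sup>2) / box_vol L
       - expectation (\<lambda>\<omega>. (S (lattice_box (resize L u p)) \<omega>)\<^sup>2) / box_vol (resize L u p)\<bar> \<le> \<epsilon>"
proof -
  obtain K where K: "K > 0" "\<And>Q. finite Q \<Longrightarrow> expectation (\<lambda>\<omega>. (S Q \<omega>)\<^sup>2) \<le> K * real (card Q)"
    using second_moment_le_card by blast
  define \<delta> where "\<delta> = (\<epsilon> / (8 * K))\<^sup>2"
  have \<delta>: "\<delta> > 0" using assms K by (simp add: \<delta>_def)
  obtain q where q: "1 \<le> q" "r q \<le> \<epsilon> / (4 * K)"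
    using r_small[of "\<epsilon> / (4 * K)"] assms K by auto
  obtain p where p: "real p > 2 * q / \<delta>" using reals_Archimedean2 by blast
  have "0 \<le> 2 * real q / \<delta>" using \<delta> by simp
  with p have p1: "1 \<le> p" by (cases p) auto
  obtain N0 where N0: "real N0 > 2 * (p + q) / \<delta>" using reals_Archimedean2 by blast
  show ?thesis
  proof (rule that[OF p1])
    fix L :: "nat ^ 'd" and u assume L: "\<And>v. L $ v > 0" and N: "N0 \<le> L $ u"
    define m where "m = L $ u div (p + q)"
    have m: "m * (p + q) \<le> L $ u" by (simp add: m_def)
    have rem: "L $ u < m * (p + q) + (p + q)"
      unfolding m_def using p1 dividend_less_div_times[of "p + q" "L $ u"] by simp
    have Npos: "0 < real (L $ u)" using L[of u] by simp
    have "real (L $ u - m * p) \<le> real m * q + real (p + q)"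
    proof -
      have "L $ u - m * p \<le> m * q + (p + q)" using rem by (simp add: algebra_simps)
      then have "real (L $ u - m * p) \<le> real (m * q + (p + q))" by (simp only: of_nat_le_iff)
      then show ?thesis by simp
    qed
    also have "real m * q \<le> L $ u * (q / p)"
    proof -
      have "m * p \<le> m * (p + q)" by simp
      with m have "m * p \<le> L $ u" by linarith
      then have "real m * p \<le> L $ u" by (metis of_nat_le_iff of_nat_mult)
      then have "real m * p * (q / p) \<le> L $ u * (q / p)" by (intro mult_right_mono) auto
      then show ?thesis using p1 by simp
    qed
    also have "q / p \<le> \<delta> / 2"
      using p p1 \<delta> by (simp add: field_simps)
    also have "real (p + q) \<le> L $ u * (\<delta> / 2)"
    proof -
      have "2 * (p + q) / \<delta> \<le> L $ u" using N0 N by linarith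
      then show ?thesis using \<delta> by (simp add: field_simps)
    qed
    finally have D: "real (L $ u - m * p) / L $ u \<le> \<delta>"
      using Npos by (simp add: field_simps)
    have "\<bar>expectation (\<lambda>\<omega>. (S (lattice_box L) \<omega>)\<^sup>2) / box_vol L
       - expectation (\<lambda>\<omega>. (S (lattice_box (resize L u p)) \<omega>)\<^sup>2) / box_vol (resize L u p)\<bar>
       \<le> K * (4 * sqrt ((L $ u - m * p) / L $ u) + 2 * r q)"
      using m by (intro second_moment_compare K L p1 q) auto
    also have "\<dots> \<le> K * (4 * (\<epsilon> / (8 * K)) + 2 * (\<epsilon> / (4 * K)))"
    proof (intro mult_left_mono add_mono)
      have "sqrt (real (L $ u - m * p) / L $ u) \<le> sqrt \<delta>" using D by simp
      also have "\<dots> = \<epsilon> / (8 * K)" using assms K by (simp add: \<delta>_def)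
      finally show "sqrt (real (L $ u - m * p) / L $ u) \<le> \<epsilon> / (8 * K)" .
    qed (use q K in auto)
    also have "\<dots> = \<epsilon>" using K by (simp add: field_simps)
    finally show "\<bar>expectation (\<lambda>\<omega>. (S (lattice_box L) \<omega>)\<^sup>2) / box_vol L
       - expectation (\<lambda>\<omega>. (S (lattice_box (resize L u p)) \<omega>)\<^sup>2) / box_vol (resize L u p)\<bar> \<le> \<epsilon>" .
  qed
qed

text \<open>
  The sides of a large box are replaced by \<open>p\<close> one at a time. Each side is still large at
  its turn, and the sides that are already short do no harm by uniformity.
\<close>

lemma normalized_variance_near_cube:
  assumes "\<epsilon> > 0"
  obtains c N0 where
    "\<And>L. (\<And>v. N0 \<le> L $ v) \<Longrightarrow> \<bar>expectation (\<lambda>\<omega>. (S (lattice_box L) \<omega>)\<^sup>2) / box_vol L - c\<bar> \<le> \<epsilon>"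
proof -
  define G where "G L = expectation (\<lambda>\<omega>. (S (lattice_box L) \<omega>)\<^sup>2) / box_vol L" for L
  define \<delta> where "\<delta> = \<epsilon> / CARD('d)"
  have "\<delta> > 0" using assms by (simp add: \<delta>_def)
  then obtain p N0 where p: "1 \<le> p"
    and stable: "\<And>L u. (\<And>v. L $ v > 0) \<Longrightarrow> N0 \<le> L $ u \<Longrightarrow> \<bar>G L - G (resize L u p)\<bar> \<le> \<delta>"
    using normalized_variance_stable unfolding G_def by metis
  show ?thesis
  proof (rule that[of "Suc N0" "G (\<chi> v. p)"])
    fix L :: "nat ^ 'd" assume L: "\<And>v. Suc N0 \<le> L $ v"
    define H where "H U = (\<chi> v. if v \<in> U then p else L $ v)" for U
    have "\<bar>G L - G (H U)\<bar> \<le> card U * \<delta>" if "finite U" for U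
      using that
    proof (induction U)
      case empty
      have "H {} = L" by (simp add: H_def vec_eq_iff)
      then show ?case by simp
    next
      case (insert u U)
      have "H (insert u U) = resize (H U) u p"
        using insert.hyps by (auto simp: H_def resize_def vec_eq_iff)
      moreover have "H U $ v > 0" for v
        using p L[of v] by (auto simp: H_def)
      moreover have "N0 \<le> H U $ u"
        using L[of u] insert.hyps by (simp add: H_def)
      ultimately have "\<bar>G (H U) - G (H (insert u U))\<bar> \<le> \<delta>"
        using stable[of "H U" u] by simp
      with insert show ?case by (simp add: algebra_simps)
    qed
    from this[of UNIV] show "\<bar>expectation (\<lambda>\<omega>. (S (lattice_box L) \<omega>)\<^sup>2) / box_vol L - G (\<chi> v. p)\<bar> \<le> \<epsilon>"
      by (simp add: G_def[symmetric] H_def \<delta>_def)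
  qed
qed

lemma normalized_variance_converges:
  obtains v where "v \<ge> 0"
    "((\<lambda>L. expectation (\<lambda>\<omega>. (S (lattice_box L) \<omega>)\<^sup>2) / box_vol L) \<longlongrightarrow> v) min_at_top"
proof -
  define G where "G L = expectation (\<lambda>\<omega>. (S (lattice_box L) \<omega>)\<^sup>2) / box_vol L" for L
  define g where "g n = G (\<chi> v. n)" for n
  have near: "\<exists>N0. \<forall>L n. (\<forall>v. N0 \<le> L $ v) \<and> N0 \<le> n \<longrightarrow> \<bar>G L - g n\<bar> \<le> \<epsilon>" if "\<epsilon> > 0" for \<epsilon>
  proof -
    obtain c N0 where *: "\<And>L. (\<And>v. N0 \<le> L $ v) \<Longrightarrow> \<bar>G L - c\<bar> \<le> \<epsilon> / 2"
      unfolding G_def using normalized_variance_near_cube[OF half_gt_zero[OF \<open>\<epsilon> > 0\<close>]] by blast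
    have "\<bar>G L - g n\<bar> \<le> \<epsilon>" if "\<forall>v. N0 \<le> L $ v" "N0 \<le> n" for L n
    proof -
      have "\<bar>G L - c\<bar> \<le> \<epsilon> / 2" "\<bar>G (\<chi> v. n) - c\<bar> \<le> \<epsilon> / 2"
        by (rule *, use that in simp)+
      then show ?thesis unfolding g_def abs_le_iff by linarith
    qed
    then show ?thesis by blast
  qed
  have "Cauchy g"
  proof (rule CauchyI)
    fix \<epsilon> :: real assume "\<epsilon> > 0"
    then obtain N0 where "\<And>L n. (\<forall>v. N0 \<le> L $ v) \<and> N0 \<le> n \<Longrightarrow> \<bar>G L - g n\<bar> \<le> \<epsilon> / 2"
      using near[of "\<epsilon> / 2"] by auto
    then have "\<bar>g m - g n\<bar> \<le> \<epsilon> / 2" if "N0 \<le> m" "N0 \<le> n" for m n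
      using that by (simp add: g_def)
    then show "\<exists>N. \<forall>m\<ge>N. \<forall>n\<ge>N. norm (g m - g n) < \<epsilon>"
      using \<open>\<epsilon> > 0\<close> by (intro exI[of _ N0]) (fastforce simp: le_less_trans)
  qed
  then obtain v where v: "g \<longlonglongrightarrow> v" using Cauchy_convergent_iff convergent_def by blast
  have "v \<ge> 0"
    by (rule LIMSEQ_le_const[OF v]) (auto simp: g_def G_def intro!: divide_nonneg_nonneg box_vol_nonneg)
  moreover have "(G \<longlongrightarrow> v) min_at_top"
  proof (rule tendstoI)
    fix \<epsilon> :: real assume "\<epsilon> > 0"
    then obtain N0 where N0: "\<And>L n. (\<forall>v. N0 \<le> L $ v) \<and> N0 \<le> n \<Longrightarrow> \<bar>G L - g n\<bar> \<le> \<epsilon> / 2"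
      using near[of "\<epsilon> / 2"] by auto
    have "\<bar>G L - v\<bar> \<le> \<epsilon> / 2" if "\<forall>v. N0 \<le> L $ v" for L
    proof (rule LIMSEQ_le_const2)
      show "(\<lambda>n. \<bar>G L - g n\<bar>) \<longlonglongrightarrow> \<bar>G L - v\<bar>" by (intro tendsto_intros v)
      show "\<exists>N. \<forall>n\<ge>N. \<bar>G L - g n\<bar> \<le> \<epsilon> / 2" using N0 that by blast
    qed
    then show "\<forall>\<^sub>F L in min_at_top. dist (G L) v < \<epsilon>"
      unfolding eventually_min_at_top dist_real_def
      using \<open>\<epsilon> > 0\<close> by (intro exI[of _ N0]) fastforce
  qed
  ultimately show ?thesis using that unfolding G_def by blast
qed

end

section \<open>Fourth moments of bounded fields\<close>

lemma square_add_le: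
  fixes x y :: real
  assumes "\<eta> > 0"
  shows "(x + y)\<^sup>2 \<le> (1 + \<eta>) * x\<^sup>2 + (1 + 1 / \<eta>) * y\<^sup>2"
proof -
  have "0 \<le> (\<eta> * x - y)\<^sup>2 / \<eta>" using assms by simp
  also have "\<dots> = \<eta> * x\<^sup>2 - 2 * x * y + y\<^sup>2 / \<eta>"
    using assms by (simp add: power2_eq_square field_simps)
  finally show ?thesis by (simp add: power2_sum algebra_simps)
qed

text \<open>
  What matters is that the coefficient of \<open>x ^ 4 + y ^ 4\<close> is so close to \<open>1\<close> that twice its value stays
  below \<open>4\<close>: doubling a side must multiply the fourth moment by less than \<open>4\<close>, up to lower order terms.
\<close>

lemma fourth_power_add3_le:
  fixes x y z :: real
  shows "(x + y + z) ^ 4 \<le> 21/16 * (x ^ 4 + y ^ 4) + 82 * (x\<^sup>2 * y\<^sup>2) + 9261 * z ^ 4"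
proof -
  have add: "(s + z) ^ 4 \<le> 9261 / 8000 * s ^ 4 + 9261 * z ^ 4" for s
  proof -
    have "(s + z)\<^sup>2 \<le> 21 / 20 * s\<^sup>2 + 21 * z\<^sup>2"
      using square_add_le[of "1 / 20" s z] by simp
    then have "((s + z)\<^sup>2)\<^sup>2 \<le> (21 / 20 * s\<^sup>2 + 21 * z\<^sup>2)\<^sup>2" by (intro power_mono) auto
    also have "\<dots> \<le> 21 / 20 * (21 / 20 * s\<^sup>2)\<^sup>2 + 21 * (21 * z\<^sup>2)\<^sup>2"
      using square_add_le[of "1 / 20" "21 / 20 * s\<^sup>2" "21 * z\<^sup>2"] by simp
    finally show ?thesis by (simp add: power_mult_distrib power2_eq_square power4_eq_xxxx)
  qed
  have cross: "4 * (a\<^sup>2 * (a * b)) \<le> 1 / 8 * a ^ 4 + 32 * (a\<^sup>2 * b\<^sup>2)" for a b :: real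
  proof -
    have "0 \<le> 2 * (a\<^sup>2 / 4 - 4 * (a * b))\<^sup>2" by simp
    then show ?thesis by (simp add: power2_eq_square power4_eq_xxxx algebra_simps)
  qed
  have "(x + y) ^ 4 = x ^ 4 + y ^ 4 + 6 * (x\<^sup>2 * y\<^sup>2) + 4 * (x\<^sup>2 * (x * y)) + 4 * (y\<^sup>2 * (y * x))"
    by (simp add: power2_eq_square power4_eq_xxxx algebra_simps)
  also have "\<dots> \<le> 9 / 8 * (x ^ 4 + y ^ 4) + 70 * (x\<^sup>2 * y\<^sup>2)"
    using cross[of x y] cross[of y x] by (simp add: algebra_simps)
  finally have "9261 / 8000 * (x + y) ^ 4 \<le> 9261 / 8000 * (9 / 8 * (x ^ 4 + y ^ 4) + 70 * (x\<^sup>2 * y\<^sup>2))"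
    by (intro mult_left_mono) auto
  moreover have "9261 / 8000 * (9 / 8 * (x ^ 4 + y ^ 4) + 70 * (x\<^sup>2 * y\<^sup>2))
      \<le> 21/16 * (x ^ 4 + y ^ 4) + 82 * (x\<^sup>2 * y\<^sup>2)"
  proof -
    have *: "9261 / 8000 * (9 / 8 * P + 70 * Q) \<le> 21 / 16 * P + 82 * Q"
      if "0 \<le> P" "0 \<le> Q" for P Q :: real using that by simp
    show ?thesis by (rule *) simp_all
  qed
  ultimately show ?thesis using add[of "x + y"] by linarith
qed

lemma fourth_power_sum_le:
  fixes x :: "'i \<Rightarrow> real"
  shows "(\<Sum>i\<in>I. x i) ^ 4 \<le> real (card I) ^ 3 * (\<Sum>i\<in>I. x i ^ 4)"
proof -
  have sq: "w ^ 4 = (w\<^sup>2)\<^sup>2" for w :: real by simp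
  have "(\<Sum>i\<in>I. x i) ^ 4 \<le> ((\<Sum>i\<in>I. (x i)\<^sup>2) * real (card I))\<^sup>2"
    unfolding sq by (intro power_mono sum_squared_le_sum_of_squares) auto
  also have "\<dots> = (\<Sum>i\<in>I. (x i)\<^sup>2)\<^sup>2 * (real (card I))\<^sup>2"
    by (simp add: power_mult_distrib)
  also have "\<dots> \<le> ((\<Sum>i\<in>I. ((x i)\<^sup>2)\<^sup>2) * real (card I)) * (real (card I))\<^sup>2"
    by (intro mult_right_mono sum_squared_le_sum_of_squares) auto
  finally show ?thesis
    unfolding sq[symmetric] by (simp only: power2_eq_square power3_eq_cube ac_simps)
qed

locale bounded_sum_mixing = sum_mixing M Y r
  for M :: "'a measure" and Y :: "int ^ 'd \<Rightarrow> 'a \<Rightarrow> real" and r +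
  fixes b :: real
  assumes Y_bounded: "\<And>k \<omega>. \<bar>Y k \<omega>\<bar> \<le> b"
begin

lemma integrable_continuous_S:
  assumes "finite Q" "continuous_on UNIV \<phi>"
  shows "integrable M (\<lambda>\<omega>. \<phi> (S Q \<omega>) :: real)"
proof -
  have bd: "S Q \<omega> \<in> {- (card Q * b)..card Q * b}" for \<omega>
  proof -
    have "\<bar>S Q \<omega>\<bar> \<le> card Q * b"
      unfolding field_sum_def by (intro sum_abs[THEN order_trans] sum_bounded_above Y_bounded)
    then show ?thesis by (auto simp: abs_le_iff)
  qed
  have "compact (\<phi> ` {- (card Q * b)..card Q * b})"
    using assms(2) by (intro compact_continuous_image) (auto intro: continuous_on_subset)
  then obtain c where c: "\<And>x. x \<in> {- (card Q * b)..card Q * b} \<Longrightarrow> \<bar>\<phi> x\<bar> \<le> c"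
    by (force dest!: compact_imp_bounded simp: bounded_iff)
  have "\<phi> \<in> borel_measurable borel"
    using assms(2) by (rule borel_measurable_continuous_onI)
  then show ?thesis
    by (intro integrable_const_bound[where B = c] AE_I2) (use c[OF bd] in simp_all)
qed

text \<open>
  The two blocks have the same law, and mixing applied to their squares gives
  \<open>E A\<^sup>2 B\<^sup>2 \<le> v\<^sup>2 + r(q) a\<close>. The threshold \<open>1 / 280\<close> keeps the resulting coefficient
  \<open>21/8 + 82/280\<close> of \<open>a\<close> below \<open>3\<close>.
\<close>

lemma fourth_moment_doubling:
  fixes L u p q
  defines "a \<equiv> expectation (\<lambda>\<omega>. S (lattice_box (resize L u p)) \<omega> ^ 4)"
    and "v \<equiv> expectation (\<lambda>\<omega>. (S (lattice_box (resize L u p)) \<omega>)\<^sup>2)"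
    and "R \<equiv> slab L u ({1..int (L $ u)} - blocks p q 2)"
  assumes q: "1 \<le> q" "r q \<le> 1 / 280" and L: "2 * (p + q) \<le> L $ u + q"
  shows "expectation (\<lambda>\<omega>. S (lattice_box L) \<omega> ^ 4)
    \<le> 3 * a + 82 * v\<^sup>2 + 9261 * expectation (\<lambda>\<omega>. S R \<omega> ^ 4)"
proof -
  let ?A = "slab L u (block p q 0)" and ?B = "slab L u (block p q 1)"
  have fin: "finite ?A" "finite ?B" "finite R" "finite (lattice_box L)"
    unfolding R_def by (simp_all add: finite_slab finite_block finite_box)
  have "blocks p q 2 = block p q 0 \<union> block p q 1"
    by (auto simp: blocks_def numeral_2_eq_2 less_Suc_eq)
  then have "S (slab L u (blocks p q 2)) \<omega> = S ?A \<omega> + S ?B \<omega>" for \<omega>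
    unfolding field_sum_def using fin
    by (simp add: slab_Un sum.union_disjoint slab_disjoint block_disjoint)
  then have split: "S (lattice_box L) \<omega> = S ?A \<omega> + S ?B \<omega> + S R \<omega>" for \<omega>
    using S_box_split[OF L] unfolding R_def by simp
  have sep: "separated u q ?A ?B" by (rule separated_slab_blocks) simp
  have int4: "integrable M (\<lambda>\<omega>. S Q \<omega> ^ 4)" and si: "square_integrable M (\<lambda>\<omega>. (S Q \<omega>)\<^sup>2)"
    if "finite Q" for Q
    unfolding square_integrable_def using that
    by (auto intro!: integrable_continuous_S continuous_intros simp flip: power_mult)
  have A: "expectation (\<lambda>\<omega>. S (slab L u (block p q i)) \<omega> ^ 4) = a"
    "expectation (\<lambda>\<omega>. (S (slab L u (block p q i)) \<omega>)\<^sup>2) = v" for i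
    unfolding a_def v_def by (rule expectation_S_block, measurable)+
  have int22: "integrable M (\<lambda>\<omega>. (S ?A \<omega>)\<^sup>2 * (S ?B \<omega>)\<^sup>2)"
    by (intro square_integrable_mult si fin)
  have "a \<ge> 0" by (simp add: a_def)
  have "\<bar>expectation (\<lambda>\<omega>. (S ?A \<omega>)\<^sup>2 * (S ?B \<omega>)\<^sup>2) - v * v\<bar> \<le> r q * a"
    using mixing[OF q(1) fin(1,2) sep, of "\<lambda>x. x\<^sup>2" "\<lambda>x. x\<^sup>2"] si[OF fin(1)] si[OF fin(2)] A \<open>a \<ge> 0\<close>
    by (simp flip: power_mult)
  also have "\<dots> \<le> 1 / 280 * a" using q \<open>a \<ge> 0\<close> by (intro mult_right_mono)
  finally have mix: "expectation (\<lambda>\<omega>. (S ?A \<omega>)\<^sup>2 * (S ?B \<omega>)\<^sup>2) \<le> v\<^sup>2 + a / 280"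
    unfolding power2_eq_square[of v] by linarith
  have "expectation (\<lambda>\<omega>. S (lattice_box L) \<omega> ^ 4) \<le> expectation (\<lambda>\<omega>. 21/16 * (S ?A \<omega> ^ 4 + S ?B \<omega> ^ 4)
      + 82 * ((S ?A \<omega>)\<^sup>2 * (S ?B \<omega>)\<^sup>2) + 9261 * S R \<omega> ^ 4)"
  proof (rule integral_mono)
    show "S (lattice_box L) \<omega> ^ 4 \<le> 21/16 * (S ?A \<omega> ^ 4 + S ?B \<omega> ^ 4)
      + 82 * ((S ?A \<omega>)\<^sup>2 * (S ?B \<omega>)\<^sup>2) + 9261 * S R \<omega> ^ 4" for \<omega>
      unfolding split by (rule fourth_power_add3_le)
  qed (use fin int4 int22 in auto)
  also have "\<dots> = 21/16 * (a + a) + 82 * expectation (\<lambda>\<omega>. (S ?A \<omega>)\<^sup>2 * (S ?B \<omega>)\<^sup>2)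
      + 9261 * expectation (\<lambda>\<omega>. S R \<omega> ^ 4)"
    using fin int4 int22 by (simp add: A)
  also have "\<dots> \<le> 3 * a + 82 * v\<^sup>2 + 9261 * expectation (\<lambda>\<omega>. S R \<omega> ^ 4)"
    using mix \<open>a \<ge> 0\<close> by (simp add: algebra_simps)
  finally show ?thesis .
qed

lemma fourth_moment_slab:
  assumes "finite J"
  shows "expectation (\<lambda>\<omega>. S (slab L u J) \<omega> ^ 4)
    \<le> real (card J) ^ 4 * expectation (\<lambda>\<omega>. S (lattice_box (resize L u 1)) \<omega> ^ 4)"
proof -
  let ?Q = "\<lambda>j. slab L u {j}"
  have int: "integrable M (\<lambda>\<omega>. S Q \<omega> ^ 4)" if "finite Q" for Q
    using that by (intro integrable_continuous_S continuous_intros)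
  have one: "expectation (\<lambda>\<omega>. S (?Q j) \<omega> ^ 4) = expectation (\<lambda>\<omega>. S (lattice_box (resize L u 1)) \<omega> ^ 4)" for j
  proof -
    have "{j} = (\<lambda>i. i + (j - 1)) ` {1..int 1}" by auto
    then show ?thesis
      unfolding box_resize by (simp only: slab_shift) (rule expectation_S_shift, auto intro: finite_slab)
  qed
  have "slab L u J = (\<Union>j\<in>J. ?Q j)" unfolding slab_UN[symmetric] by simp
  then have "S (slab L u J) \<omega> = (\<Sum>j\<in>J. S (?Q j) \<omega>)" for \<omega>
    by (simp only:) (intro S_union_disjoint assms finite_slab slab_disjoint, auto)
  then have "expectation (\<lambda>\<omega>. S (slab L u J) \<omega> ^ 4)
      \<le> expectation (\<lambda>\<omega>. real (card J) ^ 3 * (\<Sum>j\<in>J. S (?Q j) \<omega> ^ 4))"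
    using fourth_power_sum_le[of "\<lambda>j. S (?Q j) _" J]
    by (intro integral_mono int integrable_mult_right Bochner_Integration.integrable_sum finite_slab assms) auto
  also have "\<dots> = real (card J) ^ 3 * (\<Sum>j\<in>J. expectation (\<lambda>\<omega>. S (?Q j) \<omega> ^ 4))"
    by (simp add: int finite_slab)
  also have "\<dots> = real (card J) ^ 4 * expectation (\<lambda>\<omega>. S (lattice_box (resize L u 1)) \<omega> ^ 4)"
    by (simp add: one) (simp add: eval_nat_numeral)
  finally show ?thesis .
qed

text \<open>
  Strong induction on the side \<open>N\<close>, halving it in each step. With \<open>f(N)\<close> for the fourth moment in units
  of the squared cross section, \<open>f(N) \<le> 3 f(N/2) + O(N\<^sup>2)\<close> has a solution of order \<open>N\<^sup>2\<close> since \<open>3 < 4\<close>;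
  the gap and the odd remainder consist of at most \<open>2 q + 1\<close> slices of thickness one, which are
  bounded by the hypothesis on \<open>C\<close>.
\<close>

lemma fourth_moment_direction:
  assumes q: "1 \<le> q" "r q \<le> 1 / 280"
    and K: "K > 0" "\<And>Q. finite Q \<Longrightarrow> expectation (\<lambda>\<omega>. (S Q \<omega>)\<^sup>2) \<le> K * real (card Q)"
    and C: "C \<ge> 0" "expectation (\<lambda>\<omega>. S (lattice_box (resize L u 1)) \<omega> ^ 4) \<le> C * (cross L u)\<^sup>2"
  shows "expectation (\<lambda>\<omega>. S (lattice_box (resize L u N)) \<omega> ^ 4)
    \<le> 4 * (82 * K\<^sup>2 + 9261 * (2 * real q + 1) ^ 4 * C) * (real N * cross L u)\<^sup>2"
proof (induction N rule: less_induct)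
  case (less N)
  define c where "c = cross L u"
  define w where "w = 2 * real q + 1"
  define E where "E = 4 * (82 * K\<^sup>2 + 9261 * w ^ 4 * C)"
  have w: "w \<ge> 1" by (simp add: w_def)
  have c: "c \<ge> 0" unfolding c_def by (rule cross_nonneg)
  have E0: "E \<ge> 0" unfolding E_def using C w by auto
  have rest: "expectation (\<lambda>\<omega>. S (slab L u J) \<omega> ^ 4) \<le> real (card J) ^ 4 * (C * c\<^sup>2)" if "finite J" for J
  proof -
    note fourth_moment_slab[OF that, of L u]
    also have "real (card J) ^ 4 * expectation (\<lambda>\<omega>. S (lattice_box (resize L u 1)) \<omega> ^ 4)
        \<le> real (card J) ^ 4 * (C * c\<^sup>2)"
      using C(2) by (intro mult_left_mono) (simp_all add: c_def)
    finally show ?thesis .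
  qed
  show ?case
  proof (cases "N \<le> 2 * q")
    case True
    have "expectation (\<lambda>\<omega>. S (lattice_box (resize L u N)) \<omega> ^ 4) \<le> real N ^ 4 * (C * c\<^sup>2)"
      unfolding box_resize using rest[of "{1..int N}"] by simp
    also have "\<dots> = (real N)\<^sup>2 * C * (real N * c)\<^sup>2"
      by (simp add: power2_eq_square power4_eq_xxxx ac_simps)
    also have "\<dots> \<le> E * (real N * c)\<^sup>2"
    proof (rule mult_right_mono)
      have "(real N)\<^sup>2 \<le> w\<^sup>2" using True by (intro power_mono) (auto simp: w_def)
      also have "w\<^sup>2 \<le> w ^ 4" using w by (intro power_increasing) auto
      finally have "(real N)\<^sup>2 * C \<le> w ^ 4 * C" using C by (intro mult_right_mono)
      also have "\<dots> \<le> E"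
        unfolding E_def using C w mult_nonneg_nonneg[of "w ^ 4" C] by (simp add: mult.assoc)
      finally show "(real N)\<^sup>2 * C \<le> E" .
    qed simp
    finally show ?thesis by (simp add: E_def w_def c_def)
  next
    case False
    define p where "p = N div 2 - q"
    have pq: "p + q = N div 2" using False by (simp add: p_def)
    have m: "2 * (p + q) \<le> resize L u N $ u + q" unfolding pq by (simp add: resize_nth)
    have p: "p < N" using pq q False by simp
    have "2 * p \<le> N" using pq by linarith
    then have p2: "2 * real p \<le> N" by linarith
    define a v where "a = expectation (\<lambda>\<omega>. S (lattice_box (resize L u p)) \<omega> ^ 4)"
      and "v = expectation (\<lambda>\<omega>. (S (lattice_box (resize L u p)) \<omega>)\<^sup>2)"
    let ?R = "{1..int N} - blocks p q 2"
    have "a \<le> E * (real p * c)\<^sup>2"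
      using less[OF p] by (simp add: a_def E_def w_def c_def)
    also have "\<dots> \<le> E * (real N * c / 2)\<^sup>2"
    proof (intro mult_left_mono power_mono E0)
      show "real p * c \<le> real N * c / 2" using mult_right_mono[OF p2 c] by simp
    qed (use c in auto)
    finally have a: "a \<le> E / 4 * (real N * c)\<^sup>2" by (simp add: power2_eq_square)
    have "v \<le> K * (real p * c)"
      using K(2)[OF finite_box, of "resize L u p"] by (simp add: v_def card_box box_vol_resize c_def)
    also have "\<dots> \<le> K * (real N * c)"
      using p c K by (intro mult_left_mono mult_right_mono) auto
    finally have "v\<^sup>2 \<le> (K * (real N * c))\<^sup>2" by (intro power_mono) (auto simp: v_def)
    then have v: "v\<^sup>2 \<le> K\<^sup>2 * (real N * c)\<^sup>2" by (simp only: power_mult_distrib)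
    have "card ?R = N - 2 * p"
      using card_rest[of 2 p q N] m by (simp add: resize_nth)
    also have "\<dots> \<le> 2 * q + 1" using pq by linarith
    finally have card: "real (card ?R) \<le> w" by (simp add: w_def)
    have "expectation (\<lambda>\<omega>. S (slab L u ?R) \<omega> ^ 4) \<le> real (card ?R) ^ 4 * (C * c\<^sup>2)"
      by (rule rest) simp
    also have "\<dots> \<le> w ^ 4 * (C * c\<^sup>2)"
      using card C by (intro mult_right_mono power_mono) auto
    also have "\<dots> = w ^ 4 * C * c\<^sup>2" by simp
    also have "\<dots> \<le> w ^ 4 * C * (real N * c)\<^sup>2"
    proof (intro mult_left_mono)
      have "1 * c \<le> real N * c" using p c by (intro mult_right_mono) auto
      then show "c\<^sup>2 \<le> (real N * c)\<^sup>2" using c by (intro power_mono) auto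
    qed (use w C in auto)
    finally have R: "expectation (\<lambda>\<omega>. S (slab L u ?R) \<omega> ^ 4) \<le> w ^ 4 * C * (real N * c)\<^sup>2" .
    have "resize (resize L u N) u p = resize L u p"
      by (simp add: resize_def vec_eq_iff)
    then have "expectation (\<lambda>\<omega>. S (lattice_box (resize L u N)) \<omega> ^ 4)
        \<le> 3 * a + 82 * v\<^sup>2 + 9261 * expectation (\<lambda>\<omega>. S (slab L u ?R) \<omega> ^ 4)"
      using fourth_moment_doubling[OF q m] by (simp add: a_def v_def slab_resize resize_nth)
    also have "\<dots> \<le> 3 * (E / 4 * (real N * c)\<^sup>2) + 82 * (K\<^sup>2 * (real N * c)\<^sup>2)
        + 9261 * (w ^ 4 * C * (real N * c)\<^sup>2)"
      using a v R by (intro add_mono mult_left_mono) auto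
    also have "\<dots> = E * (real N * c)\<^sup>2"
      by (simp add: E_def algebra_simps)
    finally show ?thesis by (simp add: E_def w_def c_def)
  qed
qed

text \<open>Induction on the set of directions in which the box may have a thickness other than one.\<close>

lemma fourth_moment_bound:
  obtains C where "C \<ge> 0" "\<And>L. expectation (\<lambda>\<omega>. S (lattice_box L) \<omega> ^ 4) \<le> C * (box_vol L)\<^sup>2"
proof -
  obtain K where K: "K > 0" "\<And>Q. finite Q \<Longrightarrow> expectation (\<lambda>\<omega>. (S Q \<omega>)\<^sup>2) \<le> K * real (card Q)"
    using second_moment_le_card by blast
  obtain q where q: "1 \<le> q" "r q \<le> 1 / 280" using r_small[of "1 / 280"] by auto
  have "\<exists>C\<ge>0. \<forall>L. (\<forall>v. v \<notin> U \<longrightarrow> L $ v = 1) \<longrightarrow>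
      expectation (\<lambda>\<omega>. S (lattice_box L) \<omega> ^ 4) \<le> C * (box_vol L)\<^sup>2" if "finite U" for U
    using that
  proof (induction U)
    case empty
    let ?L = "\<chi> v. 1 :: nat ^ 'd"
    show ?case
    proof (intro exI conjI allI impI)
      fix L :: "nat ^ 'd" assume "\<forall>v. v \<notin> {} \<longrightarrow> L $ v = 1"
      then have L: "L = (\<chi> v. 1)" by (simp add: vec_eq_iff)
      show "expectation (\<lambda>\<omega>. S (lattice_box L) \<omega> ^ 4)
        \<le> expectation (\<lambda>\<omega>. S (lattice_box (\<chi> v. 1)) \<omega> ^ 4) * (box_vol L)\<^sup>2"
        unfolding L by (simp add: box_vol_def)
    qed simp
  next
    case (insert u U)
    then obtain C where C: "C \<ge> 0" "\<And>L. (\<And>v. v \<notin> U \<Longrightarrow> L $ v = 1) \<Longrightarrow>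
      expectation (\<lambda>\<omega>. S (lattice_box L) \<omega> ^ 4) \<le> C * (box_vol L)\<^sup>2" by blast
    let ?E = "4 * (82 * K\<^sup>2 + 9261 * (2 * real q + 1) ^ 4 * C)"
    show ?case
    proof (intro exI conjI allI impI)
      show "?E \<ge> 0" using C by auto
      fix L :: "nat ^ 'd" assume L: "\<forall>v. v \<notin> insert u U \<longrightarrow> L $ v = 1"
      have "expectation (\<lambda>\<omega>. S (lattice_box (resize L u 1)) \<omega> ^ 4) \<le> C * (cross L u)\<^sup>2"
        using C(2)[of "resize L u 1"] L by (simp add: resize_nth box_vol_resize)
      from fourth_moment_direction[OF q K C(1) this, of "L $ u"]
      show "expectation (\<lambda>\<omega>. S (lattice_box L) \<omega> ^ 4) \<le> ?E * (box_vol L)\<^sup>2"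
        by (simp only: resize_same box_vol_cross[of L u])
    qed
  qed
  from this[of UNIV] show ?thesis using that by auto
qed

end

section \<open>Transforms of a mixing field\<close>

context prob_space
begin

lemma cov_eq:
  assumes "square_integrable M f" "square_integrable M g"
  shows "cov M f g = expectation (\<lambda>\<omega>. f \<omega> * g \<omega>) - expectation f * expectation g"
  using square_integrable_mult[OF assms] assms[THEN square_integrable_integrable]
  unfolding cov_def by (simp add: algebra_simps prob_space)

lemma abs_cov_le:
  assumes f: "square_integrable M f" and g: "square_integrable M g"
  shows "\<bar>cov M f g\<bar> \<le> sqrt (variance f * variance g)"
proof -
  have const: "square_integrable M (\<lambda>_. c)" for c by (simp add: square_integrable_def)
  show ?thesis
    unfolding cov_def by (intro Cauchy_Schwarz_integral square_integrable_diff f g const)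
qed

lemma abs_corr_le_1:
  assumes "square_integrable M f" "square_integrable M g"
  shows "\<bar>corr M f g\<bar> \<le> 1"
proof -
  define w where "w = sqrt (variance f * variance g)"
  have "w \<ge> 0" "\<bar>cov M f g\<bar> \<le> w" using abs_cov_le[OF assms] by (auto simp: w_def)
  then show ?thesis
    unfolding corr_def w_def[symmetric] by (auto simp: abs_divide divide_le_eq_1)
qed

text \<open>
  For degenerate variables both sides vanish: the correlation is zero by convention and the
  covariance by the Cauchy--Schwarz inequality.
\<close>

lemma abs_cov_corr:
  assumes "square_integrable M f" "square_integrable M g"
  shows "\<bar>cov M f g\<bar> = \<bar>corr M f g\<bar> * sqrt (variance f * variance g)"
proof -
  define w where "w = sqrt (variance f * variance g)"
  have "w \<ge> 0" "\<bar>cov M f g\<bar> \<le> w" using abs_cov_le[OF assms] by (auto simp: w_def)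
  then show ?thesis
    unfolding corr_def w_def[symmetric] by (cases "w = 0") (auto simp: abs_divide)
qed

end

lemma space_gen_field: "space (gen_field M X Q) = space M"
  unfolding gen_field_def by (rule space_measure_of) auto

lemma sets_gen_field_subset:
  assumes "\<And>k. X k \<in> borel_measurable M"
  shows "sets (gen_field M X Q) \<subseteq> sets M"
  unfolding gen_field_def
  by (subst sets_measure_of) (use assms in \<open>auto intro!: sets.sigma_sets_subset measurable_sets\<close>)

lemma measurable_gen_field_mono:
  assumes "\<And>k. X k \<in> borel_measurable M" "f \<in> borel_measurable (gen_field M X Q)"
  shows "f \<in> borel_measurable M"
  using measurable_sets[OF assms(2)] sets_gen_field_subset[of X M Q, OF assms(1)]
  by (intro measurableI) (auto simp: space_gen_field)

lemma measurable_gen_field: "k \<in> Q \<Longrightarrow> X k \<in> borel_measurable (gen_field M X Q)"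
proof (rule measurableI)
  fix A :: "real set" assume k: "k \<in> Q" and A: "A \<in> sets borel"
  have "X k -` A \<inter> space M \<in> sigma_sets (space M) {X k -` U \<inter> space M |k U. k \<in> Q \<and> U \<in> sets borel}"
    using k A by (intro sigma_sets.Basic) blast
  then show "X k -` A \<inter> space (gen_field M X Q) \<in> sets (gen_field M X Q)"
    unfolding space_gen_field unfolding gen_field_def by (subst sets_measure_of) auto
qed simp

text \<open>
  The witnessing sets of positions are images in the reals, since the distance in the definition
  of separated pairs is that of the reals.
\<close>

lemma separated_in_separated_pairs:
  assumes "finite Q" "finite R" "Q \<noteq> {}" "R \<noteq> {}" "1 \<le> n" "separated u n Q R"
  shows "(Q, R) \<in> separated_pairs n"
proof -
  let ?A = "(\<lambda>k. real_of_int (k $ u)) ` Q" and ?B = "(\<lambda>k. real_of_int (k $ u)) ` R"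
  have dist: "real n \<le> dist a b" if ab: "a \<in> ?A" "b \<in> ?B" for a b
  proof -
    from ab obtain k l where kl: "k \<in> Q" "l \<in> R" "a = real_of_int (k $ u)" "b = real_of_int (l $ u)"
      by blast
    then have "int n \<le> \<bar>k $ u - l $ u\<bar>" using assms(6) unfolding separated_def by blast
    then have "real n \<le> real_of_int \<bar>k $ u - l $ u\<bar>" by linarith
    then show ?thesis by (simp add: kl dist_real_def)
  qed
  have AB: "?A \<inter> ?B = {}"
  proof (rule ccontr)
    assume "?A \<inter> ?B \<noteq> {}"
    then obtain a where "a \<in> ?A" "a \<in> ?B" by blast
    from dist[OF this] assms(5) show False by simp
  qed
  then have "Q \<inter> R = {}" by blast
  moreover have "setdist ?A ?B \<ge> real n"
    unfolding le_setdist_iff using dist assms(3,4) by blast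
  moreover have "Q \<subseteq> {k. real_of_int (k $ u) \<in> ?A}" "R \<subseteq> {k. real_of_int (k $ u) \<in> ?B}" by auto
  ultimately show ?thesis
    unfolding separated_pairs_def mem_Collect_eq prod.case using assms(1-4) AB
    by (intro conjI exI[of _ u] exI[of _ ?A] exI[of _ ?B]) simp_all
qed

locale rho_mixing_field = prob_space M
  for M :: "'a measure" +
  fixes X :: "int ^ 'd \<Rightarrow> 'a \<Rightarrow> real"
  assumes field: "random_field M X"
    and stationary: "strictly_stationary M X"
    and rho_mixing: "rho_prime_mixing M X"
    and X_square: "integrable M (\<lambda>\<omega>. (X 0 \<omega>)\<^sup>2)"
    and X_mean: "expectation (X 0) = 0"
begin

lemma X_measurable [measurable]: "X k \<in> borel_measurable M"
  using field by (simp add: random_field_def)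

lemma L2_square_integrable: "f \<in> L2_real M (gen_field M X Q) \<Longrightarrow> square_integrable M f"
  unfolding L2_real_def square_integrable_def mem_Collect_eq
  by (blast intro: measurable_gen_field_mono X_measurable)

lemma zero_L2: "(\<lambda>_. 0) \<in> L2_real M A"
  by (simp add: L2_real_def)

lemma corr_le_max_corr:
  assumes "f \<in> L2_real M (gen_field M X Q)" "g \<in> L2_real M (gen_field M X R)"
  shows "\<bar>corr M f g\<bar> \<le> max_corr M (gen_field M X Q) (gen_field M X R)"
  unfolding max_corr_def
proof (rule cSUP_upper2[where x = "(f, g)"])
  show "bdd_above ((\<lambda>(f, g). \<bar>corr M f g\<bar>) ` (L2_real M (gen_field M X Q) \<times> L2_real M (gen_field M X R)))"
    by (intro bdd_aboveI[of _ 1]) (auto intro: abs_corr_le_1 L2_square_integrable)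
qed (use assms in auto)

lemma max_corr_le_1: "max_corr M (gen_field M X Q) (gen_field M X R) \<le> 1"
  unfolding max_corr_def
  by (intro cSUP_least) (use zero_L2 in \<open>auto intro: abs_corr_le_1 L2_square_integrable\<close>)

lemma max_corr_le_rho_prime:
  assumes "(Q, R) \<in> separated_pairs n"
  shows "max_corr M (gen_field M X Q) (gen_field M X R) \<le> rho_prime M X n"
  unfolding rho_prime_def
proof (rule cSUP_upper2[OF _ assms])
  show "bdd_above ((\<lambda>(Q, S). max_corr M (gen_field M X Q) (gen_field M X S)) ` separated_pairs n)"
    by (intro bdd_aboveI[of _ 1]) (auto intro: max_corr_le_1)
qed simp

lemma covariance_le_rho_prime:
  assumes f: "f \<in> L2_real M (gen_field M X Q)" and g: "g \<in> L2_real M (gen_field M X R)"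
    and QR: "(Q, R) \<in> separated_pairs n"
  shows "\<bar>expectation (\<lambda>\<omega>. f \<omega> * g \<omega>) - expectation f * expectation g\<bar>
    \<le> \<bar>rho_prime M X n\<bar> * sqrt (expectation (\<lambda>\<omega>. (f \<omega>)\<^sup>2) * expectation (\<lambda>\<omega>. (g \<omega>)\<^sup>2))"
proof -
  note si = f[THEN L2_square_integrable] g[THEN L2_square_integrable]
  have var: "variance h \<le> expectation (\<lambda>\<omega>. (h \<omega>)\<^sup>2)" if "square_integrable M h" for h
    using that square_integrable_integrable[OF that]
    by (subst variance_eq) (auto simp: square_integrable_def)
  have "\<bar>expectation (\<lambda>\<omega>. f \<omega> * g \<omega>) - expectation f * expectation g\<bar>
      = \<bar>corr M f g\<bar> * sqrt (variance f * variance g)"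
    using cov_eq[OF si] abs_cov_corr[OF si] by simp
  also have "\<dots> \<le> \<bar>rho_prime M X n\<bar> * sqrt (expectation (\<lambda>\<omega>. (f \<omega>)\<^sup>2) * expectation (\<lambda>\<omega>. (g \<omega>)\<^sup>2))"
  proof (rule mult_mono)
    show "\<bar>corr M f g\<bar> \<le> \<bar>rho_prime M X n\<bar>"
      using corr_le_max_corr[OF f g] max_corr_le_rho_prime[OF QR] by linarith
    show "sqrt (variance f * variance g) \<le> sqrt (expectation (\<lambda>\<omega>. (f \<omega>)\<^sup>2) * expectation (\<lambda>\<omega>. (g \<omega>)\<^sup>2))"
      by (intro real_sqrt_le_mono mult_mono var si) auto
  qed auto
  finally show ?thesis .
qed

lemma distr_transform_shift:
  fixes h :: "real \<Rightarrow> real"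
  assumes [measurable]: "h \<in> borel_measurable borel" and "finite Q"
  shows "distr M borel (\<lambda>\<omega>. \<Sum>k\<in>Q. h (X (k + j) \<omega>)) = distr M borel (\<lambda>\<omega>. \<Sum>k\<in>Q. h (X k \<omega>))"
proof -
  let ?P = "Pi\<^sub>M Q (\<lambda>_. borel :: real measure)"
  let ?f = "\<lambda>x. \<Sum>k\<in>Q. h (x k)"
  have [measurable]: "?f \<in> borel_measurable ?P" by measurable
  have *: "distr M borel (\<lambda>\<omega>. \<Sum>k\<in>Q. h (X (k + i) \<omega>)) = distr (distr M ?P (\<lambda>\<omega>. \<lambda>k\<in>Q. X (k + i) \<omega>)) borel ?f" for i
    by (subst distr_distr) (auto simp: o_def intro!: distr_cong)
  show ?thesis
    using *[of j] *[of 0] stationary \<open>finite Q\<close> unfolding strictly_stationary_def by simp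
qed

text \<open>
  A sum of transformed variables is measurable with respect to the \<open>\<sigma>\<close>-field of the original ones, so
  transforms inherit the mixing coefficients. Taking absolute values makes the sequence
  nonnegative without affecting its limit. An empty index set is treated separately because
  separated pairs consist of nonempty sets.
\<close>

lemma sum_mixing_transform:
  fixes h :: "real \<Rightarrow> real"
  assumes [measurable]: "h \<in> borel_measurable borel"
    and sq: "integrable M (\<lambda>\<omega>. (h (X 0 \<omega>))\<^sup>2)" and mean: "expectation (\<lambda>\<omega>. h (X 0 \<omega>)) = 0"
  shows "sum_mixing M (\<lambda>k \<omega>. h (X k \<omega>)) (\<lambda>n. \<bar>rho_prime M X n\<bar>)"
proof
  let ?S = "field_sum (\<lambda>k \<omega>. h (X k \<omega>))"
  show "(\<lambda>n. \<bar>rho_prime M X n\<bar>) \<longlonglongrightarrow> 0"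
    using rho_mixing unfolding rho_prime_mixing_def by (rule tendsto_rabs_zero)
  fix u n and Q R :: "(int ^ 'd) set" and \<phi> \<psi> :: "real \<Rightarrow> real"
  assume n: "1 \<le> n" and fin: "finite Q" "finite R" and sep: "separated u n Q R"
    and [measurable]: "\<phi> \<in> borel_measurable borel" "\<psi> \<in> borel_measurable borel"
    and si: "square_integrable M (\<lambda>\<omega>. \<phi> (?S Q \<omega>))" "square_integrable M (\<lambda>\<omega>. \<psi> (?S R \<omega>))"
  have S_meas: "(\<lambda>\<omega>. \<theta> (?S P \<omega>)) \<in> borel_measurable (gen_field M X P)"
    if [measurable]: "\<theta> \<in> borel_measurable borel" for \<theta> :: "real \<Rightarrow> real" and P
  proof -
    have [measurable]: "(\<lambda>\<omega>. h (X k \<omega>)) \<in> borel_measurable (gen_field M X P)" if "k \<in> P" for k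
      using measurable_gen_field[OF that, of X M] by measurable
    have [measurable]: "?S P \<in> borel_measurable (gen_field M X P)"
      unfolding field_sum_def[abs_def] by measurable
    show ?thesis by measurable
  qed
  show "\<bar>expectation (\<lambda>\<omega>. \<phi> (?S Q \<omega>) * \<psi> (?S R \<omega>))
      - expectation (\<lambda>\<omega>. \<phi> (?S Q \<omega>)) * expectation (\<lambda>\<omega>. \<psi> (?S R \<omega>))\<bar>
    \<le> \<bar>rho_prime M X n\<bar> * sqrt (expectation (\<lambda>\<omega>. (\<phi> (?S Q \<omega>))\<^sup>2) * expectation (\<lambda>\<omega>. (\<psi> (?S R \<omega>))\<^sup>2))"
  proof (cases "Q = {} \<or> R = {}")
    case True
    then show ?thesis by (auto simp: field_sum_def prob_space)
  next
    case False
    show ?thesis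
      using si S_meas fin n sep False
      by (intro covariance_le_rho_prime[of _ Q _ R] separated_in_separated_pairs)
         (auto simp: L2_real_def square_integrable_def)
  qed
qed (use sq mean distr_transform_shift in auto)

sublocale sum_mixing M X "\<lambda>n. \<bar>rho_prime M X n\<bar>"
  using sum_mixing_transform[of "\<lambda>x. x"] X_square X_mean by simp

end

section \<open>Uniform integrability by truncation\<close>

definition trunc :: "real \<Rightarrow> real \<Rightarrow> real" where
  "trunc c x = max (- c) (min c x)"

lemma trunc_measurable [measurable]: "trunc c \<in> borel_measurable borel"
  unfolding trunc_def[abs_def] by measurable

lemma abs_trunc_le: "c \<ge> 0 \<Longrightarrow> \<bar>trunc c x\<bar> \<le> c"
  by (auto simp: trunc_def)

lemma abs_diff_trunc_le: "c \<ge> 0 \<Longrightarrow> \<bar>x - trunc c x\<bar> \<le> \<bar>x\<bar>"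
  by (auto simp: trunc_def)

text \<open>
  The larger of \<open>y\<close> and \<open>z\<close> controls the sum up to a factor two; the cubic branch is used if this
  is \<open>y\<close>, the quadratic one if it is \<open>z\<close>.
\<close>

lemma min_square_cube_add_le:
  fixes s y z :: real
  assumes "s \<ge> 0"
  shows "min (6 * (y + z)\<^sup>2) (s * \<bar>y + z\<bar> ^ 3) \<le> 8 * s * \<bar>y\<bar> ^ 3 + 24 * z\<^sup>2"
proof (cases "\<bar>z\<bar> \<le> \<bar>y\<bar>")
  case True
  then have "\<bar>y + z\<bar> ^ 3 \<le> (2 * \<bar>y\<bar>) ^ 3" by (intro power_mono) auto
  then have "s * \<bar>y + z\<bar> ^ 3 \<le> s * (8 * \<bar>y\<bar> ^ 3)"
    using assms by (intro mult_left_mono) (auto simp: power_mult_distrib)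
  then show ?thesis by (simp add: min.coboundedI2 add_increasing2)
next
  case False
  then have "\<bar>y + z\<bar>\<^sup>2 \<le> (2 * \<bar>z\<bar>)\<^sup>2" by (intro power_mono) auto
  then have "6 * (y + z)\<^sup>2 \<le> 24 * z\<^sup>2" by (simp add: power_mult_distrib)
  then show ?thesis using assms by (simp add: min.coboundedI1 add_increasing)
qed

context rho_mixing_field
begin

lemma truncation_error_tendsto:
  "(\<lambda>n. expectation (\<lambda>\<omega>. (X 0 \<omega> - trunc (real n) (X 0 \<omega>))\<^sup>2)) \<longlonglongrightarrow> 0"
proof -
  have "(\<lambda>n. expectation (\<lambda>\<omega>. (X 0 \<omega> - trunc (real n) (X 0 \<omega>))\<^sup>2)) \<longlonglongrightarrow> expectation (\<lambda>\<omega>. 0)"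
  proof (rule integral_dominated_convergence[where w = "\<lambda>\<omega>. (X 0 \<omega>)\<^sup>2"])
    show "AE \<omega> in M. (\<lambda>n. (X 0 \<omega> - trunc (real n) (X 0 \<omega>))\<^sup>2) \<longlonglongrightarrow> 0"
    proof (intro AE_I2 tendsto_eventually)
      fix \<omega>
      obtain N :: nat where "\<bar>X 0 \<omega>\<bar> \<le> N" using real_arch_simple by blast
      then show "\<forall>\<^sub>F n in sequentially. (X 0 \<omega> - trunc (real n) (X 0 \<omega>))\<^sup>2 = 0"
        by (intro eventually_sequentiallyI[of N]) (auto simp: trunc_def)
    qed
    show "AE \<omega> in M. norm ((X 0 \<omega> - trunc (real n) (X 0 \<omega>))\<^sup>2) \<le> (X 0 \<omega>)\<^sup>2" for n
      using abs_diff_trunc_le[of "real n"] by (auto simp flip: abs_le_square_iff)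
  qed (use X_square in auto)
  then show ?thesis by simp
qed

text \<open>
  Centring the truncated variable costs nothing in second moment: since \<open>X 0\<close> has mean zero, the
  remainder becomes \<open>X 0 - trunc n (X 0)\<close> minus its own mean.
\<close>

lemma truncation:
  assumes "\<delta> > 0"
  obtains h b where "bounded_sum_mixing M (\<lambda>k \<omega>. h (X k \<omega>)) (\<lambda>n. \<bar>rho_prime M X n\<bar>) b"
    "sum_mixing M (\<lambda>k \<omega>. X k \<omega> - h (X k \<omega>)) (\<lambda>n. \<bar>rho_prime M X n\<bar>)"
    "expectation (\<lambda>\<omega>. (X 0 \<omega> - h (X 0 \<omega>))\<^sup>2) \<le> \<delta>"
proof -
  have "\<forall>\<^sub>F n in sequentially. expectation (\<lambda>\<omega>. (X 0 \<omega> - trunc (real n) (X 0 \<omega>))\<^sup>2) < \<delta>"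
    using truncation_error_tendsto assms by (intro order_tendstoD)
  then obtain n where n: "expectation (\<lambda>\<omega>. (X 0 \<omega> - trunc (real n) (X 0 \<omega>))\<^sup>2) < \<delta>"
    using eventually_happens by force
  define \<tau> where "\<tau> x = trunc (real n) x" for x
  define a where "a = expectation (\<lambda>\<omega>. \<tau> (X 0 \<omega>))"
  define h where "h x = \<tau> x - a" for x
  have [measurable]: "\<tau> \<in> borel_measurable borel" unfolding \<tau>_def[abs_def] by measurable
  have [measurable]: "h \<in> borel_measurable borel" unfolding h_def[abs_def] by measurable
  have \<tau>: "\<bar>\<tau> x\<bar> \<le> n" for x unfolding \<tau>_def by (rule abs_trunc_le) simp
  have si_\<tau>: "square_integrable M (\<lambda>\<omega>. \<tau> (X 0 \<omega>))"
    unfolding square_integrable_def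
    by (intro conjI integrable_const_bound[where B = "(real n)\<^sup>2"] AE_I2)
       (use \<tau> in \<open>auto simp: abs_le_square_iff[symmetric]\<close>)
  have si_c: "square_integrable M (\<lambda>_. c)" for c by (simp add: square_integrable_def)
  have si_X: "square_integrable M (X 0)" using X_square by (simp add: square_integrable_def)
  have si_h: "square_integrable M (\<lambda>\<omega>. h (X 0 \<omega>))"
    unfolding h_def by (intro square_integrable_diff si_\<tau> si_c)
  have si_d: "square_integrable M (\<lambda>\<omega>. X 0 \<omega> - h (X 0 \<omega>))"
    by (intro square_integrable_diff si_X si_h)
  have int: "integrable M (\<lambda>\<omega>. \<tau> (X 0 \<omega>))" "integrable M (X 0)"
    using si_\<tau> si_X by (auto intro: square_integrable_integrable)
  have mean: "expectation (\<lambda>\<omega>. h (X 0 \<omega>)) = 0"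
    using int by (simp add: h_def a_def prob_space)
  have hb: "\<bar>h x\<bar> \<le> n + \<bar>a\<bar>" for x using \<tau>[of x] by (simp add: h_def)
  show ?thesis
  proof (rule that)
    show "bounded_sum_mixing M (\<lambda>k \<omega>. h (X k \<omega>)) (\<lambda>n. \<bar>rho_prime M X n\<bar>) (n + \<bar>a\<bar>)"
      unfolding bounded_sum_mixing_def bounded_sum_mixing_axioms_def
      using sum_mixing_transform[of h] si_h mean hb by (simp add: square_integrable_def)
    have "expectation (\<lambda>\<omega>. X 0 \<omega> - h (X 0 \<omega>)) = 0"
      using mean X_mean int si_h[THEN square_integrable_integrable] by simp
    then show "sum_mixing M (\<lambda>k \<omega>. X k \<omega> - h (X k \<omega>)) (\<lambda>n. \<bar>rho_prime M X n\<bar>)"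
      using si_d by (intro sum_mixing_transform[of "\<lambda>x. x - h x"]) (auto simp: square_integrable_def)
    have si_e: "square_integrable M (\<lambda>\<omega>. X 0 \<omega> - \<tau> (X 0 \<omega>))"
      by (intro square_integrable_diff si_X si_\<tau>)
    have "expectation (\<lambda>\<omega>. X 0 \<omega> - \<tau> (X 0 \<omega>)) = - a"
      using int X_mean by (simp add: a_def)
    then have "expectation (\<lambda>\<omega>. (X 0 \<omega> - h (X 0 \<omega>))\<^sup>2) = variance (\<lambda>\<omega>. X 0 \<omega> - \<tau> (X 0 \<omega>))"
      by (simp add: h_def algebra_simps)
    also have "\<dots> \<le> expectation (\<lambda>\<omega>. (X 0 \<omega> - \<tau> (X 0 \<omega>))\<^sup>2)"
      using si_e square_integrable_integrable[OF si_e]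
      by (subst variance_eq) (auto simp: square_integrable_def)
    finally show "expectation (\<lambda>\<omega>. (X 0 \<omega> - h (X 0 \<omega>))\<^sup>2) \<le> \<delta>"
      using n by (simp add: \<tau>_def)
  qed
qed

text \<open>
  This plays the role of the Lindeberg condition. The left-hand side is the remainder of the
  quadratic expansion of the characteristic function at \<open>s\<close>; for \<open>s\<close> of order
  \<open>1 / sqrt (m * box_vol L)\<close> the bound is \<open>box_vol L\<close> times \<open>\<epsilon> + O(1 / sqrt m)\<close>, uniformly in \<open>L\<close>.
  The cube of the truncated part lies between its second and its fourth moment by the
  Cauchy--Schwarz inequality.
\<close>

lemma truncated_third_moment_bound:
  assumes "\<epsilon> > 0"
  obtains C where "C \<ge> 0" "\<And>L s. s \<ge> 0 \<Longrightarrow>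
    expectation (\<lambda>\<omega>. min (6 * (S (lattice_box L) \<omega>)\<^sup>2) (s * \<bar>S (lattice_box L) \<omega>\<bar> ^ 3))
      \<le> box_vol L * (\<epsilon> + C * s * sqrt (box_vol L))"
proof -
  obtain n where n: "1 \<le> n" "\<bar>rho_prime M X n\<bar> \<le> 1 / 2" using r_small[of "1 / 2"] by auto
  define K where "K = real (3 * n) ^ CARD('d)"
  have K: "K > 0" using n by (simp add: K_def)
  obtain h b where h: "bounded_sum_mixing M (\<lambda>k \<omega>. h (X k \<omega>)) (\<lambda>n. \<bar>rho_prime M X n\<bar>) b"
    and d: "sum_mixing M (\<lambda>k \<omega>. X k \<omega> - h (X k \<omega>)) (\<lambda>n. \<bar>rho_prime M X n\<bar>)"
    and small: "expectation (\<lambda>\<omega>. (X 0 \<omega> - h (X 0 \<omega>))\<^sup>2) \<le> \<epsilon> / (24 * K)"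
    using truncation[of "\<epsilon> / (24 * K)"] K assms by auto
  interpret T: bounded_sum_mixing M "\<lambda>k \<omega>. h (X k \<omega>)" "\<lambda>n. \<bar>rho_prime M X n\<bar>" b by (rule h)
  interpret D: sum_mixing M "\<lambda>k \<omega>. X k \<omega> - h (X k \<omega>)" "\<lambda>n. \<bar>rho_prime M X n\<bar>" by (rule d)
  obtain K2 where K2: "K2 > 0" "\<And>Q. finite Q \<Longrightarrow> expectation (\<lambda>\<omega>. (T.S Q \<omega>)\<^sup>2) \<le> K2 * real (card Q)"
    using T.second_moment_le_card by blast
  obtain K4 where K4: "K4 \<ge> 0" "\<And>L. expectation (\<lambda>\<omega>. T.S (lattice_box L) \<omega> ^ 4) \<le> K4 * (box_vol L)\<^sup>2"
    using T.fourth_moment_bound by blast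
  show ?thesis
  proof (rule that[of "8 * sqrt (K2 * K4)"])
    show "0 \<le> 8 * sqrt (K2 * K4)" using K2 K4 by simp
    fix L :: "nat ^ 'd" and s :: real assume s: "s \<ge> 0"
    define Q V where "Q = lattice_box L" and "V = box_vol L"
    have Q: "finite Q" by (simp add: Q_def finite_box)
    have V: "V \<ge> 0" by (simp add: V_def box_vol_nonneg)
    have split: "S Q \<omega> = T.S Q \<omega> + D.S Q \<omega>" for \<omega>
      by (simp add: field_sum_def sum_subtractf)
    have T4: "square_integrable M (\<lambda>\<omega>. (T.S Q \<omega>)\<^sup>2)" and T2: "square_integrable M (\<lambda>\<omega>. \<bar>T.S Q \<omega>\<bar>)"
      unfolding square_integrable_def using Q
      by (auto intro!: T.integrable_continuous_S continuous_intros simp flip: power_mult)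
    have T3: "integrable M (\<lambda>\<omega>. \<bar>T.S Q \<omega>\<bar> ^ 3)"
      by (intro T.integrable_continuous_S continuous_intros Q)
    have D2: "integrable M (\<lambda>\<omega>. (D.S Q \<omega>)\<^sup>2)"
      using D.square_integrable_S by (simp add: square_integrable_def)
    have "expectation (\<lambda>\<omega>. \<bar>T.S Q \<omega>\<bar> ^ 3) = expectation (\<lambda>\<omega>. \<bar>T.S Q \<omega>\<bar> * (T.S Q \<omega>)\<^sup>2)"
    proof (intro arg_cong[where f = expectation] ext)
      fix \<omega>
      have "\<bar>T.S Q \<omega>\<bar> ^ 3 = \<bar>T.S Q \<omega>\<bar> * \<bar>T.S Q \<omega>\<bar>\<^sup>2"
        by (simp only: power3_eq_cube power2_eq_square mult.assoc)
      then show "\<bar>T.S Q \<omega>\<bar> ^ 3 = \<bar>T.S Q \<omega>\<bar> * (T.S Q \<omega>)\<^sup>2" by simp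
    qed
    also have "\<dots> \<le> sqrt (expectation (\<lambda>\<omega>. (T.S Q \<omega>)\<^sup>2) * expectation (\<lambda>\<omega>. T.S Q \<omega> ^ 4))"
      using Cauchy_Schwarz_integral[OF T2 T4] by (simp flip: power_mult)
    also have "\<dots> \<le> sqrt ((K2 * V) * (K4 * V\<^sup>2))"
      using K2(2)[OF Q] K4(2)[of L] K2(1) V
      by (intro real_sqrt_le_mono mult_mono) (auto simp: Q_def V_def card_box)
    also have "\<dots> = sqrt (K2 * K4) * V * sqrt V"
      using V by (simp add: real_sqrt_mult)
    finally have third: "expectation (\<lambda>\<omega>. \<bar>T.S Q \<omega>\<bar> ^ 3) \<le> sqrt (K2 * K4) * V * sqrt V" .
    have "expectation (\<lambda>\<omega>. (D.S Q \<omega>)\<^sup>2) \<le> K * V * expectation (\<lambda>\<omega>. (X 0 \<omega> - h (X 0 \<omega>))\<^sup>2)"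
      using D.second_moment_bound[OF n Q] by (simp add: K_def Q_def V_def card_box)
    also have "\<dots> \<le> K * V * (\<epsilon> / (24 * K))"
      using small K V by (intro mult_left_mono) auto
    finally have second: "24 * expectation (\<lambda>\<omega>. (D.S Q \<omega>)\<^sup>2) \<le> V * \<epsilon>"
      using K by (simp add: field_simps)
    have "expectation (\<lambda>\<omega>. min (6 * (S Q \<omega>)\<^sup>2) (s * \<bar>S Q \<omega>\<bar> ^ 3))
        \<le> expectation (\<lambda>\<omega>. 8 * s * \<bar>T.S Q \<omega>\<bar> ^ 3 + 24 * (D.S Q \<omega>)\<^sup>2)"
    proof (rule integral_mono)
      show "integrable M (\<lambda>\<omega>. min (6 * (S Q \<omega>)\<^sup>2) (s * \<bar>S Q \<omega>\<bar> ^ 3))"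
      proof (rule Bochner_Integration.integrable_bound)
        show "integrable M (\<lambda>\<omega>. 6 * (S Q \<omega>)\<^sup>2)"
          using square_integrable_S by (simp add: square_integrable_def)
      qed (use s in auto)
      show "integrable M (\<lambda>\<omega>. 8 * s * \<bar>T.S Q \<omega>\<bar> ^ 3 + 24 * (D.S Q \<omega>)\<^sup>2)"
        using T3 D2 by simp
      show "min (6 * (S Q \<omega>)\<^sup>2) (s * \<bar>S Q \<omega>\<bar> ^ 3) \<le> 8 * s * \<bar>T.S Q \<omega>\<bar> ^ 3 + 24 * (D.S Q \<omega>)\<^sup>2" for \<omega>
        unfolding split by (rule min_square_cube_add_le[OF s])
    qed
    also have "\<dots> = 8 * s * expectation (\<lambda>\<omega>. \<bar>T.S Q \<omega>\<bar> ^ 3) + 24 * expectation (\<lambda>\<omega>. (D.S Q \<omega>)\<^sup>2)"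
      using T3 D2 by simp
    also have "\<dots> \<le> 8 * s * (sqrt (K2 * K4) * V * sqrt V) + V * \<epsilon>"
      using s by (intro add_mono mult_left_mono third second) auto
    also have "\<dots> = V * (\<epsilon> + 8 * sqrt (K2 * K4) * s * sqrt V)" by (simp add: algebra_simps)
    finally show "expectation (\<lambda>\<omega>. min (6 * (S (lattice_box L) \<omega>)\<^sup>2) (s * \<bar>S (lattice_box L) \<omega>\<bar> ^ 3))
        \<le> box_vol L * (\<epsilon> + 8 * sqrt (K2 * K4) * s * sqrt (box_vol L))"
      by (simp add: Q_def V_def)
  qed
qed

end

section \<open>Characteristic functions of block sums\<close>

context prob_space
begin

lemma char_distr:
  assumes [measurable]: "f \<in> borel_measurable M"
  shows "char (distr M borel f) t = (CLINT \<omega>|M. iexp (t * f \<omega>))"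
  unfolding char_def by (subst integral_distr) auto

lemma integrable_iexp_times:
  assumes [measurable]: "f \<in> borel_measurable M"
  shows "integrable M (\<lambda>\<omega>. iexp (t * f \<omega>))"
  by (rule integrable_iexp) auto

lemma
  assumes [measurable]: "f \<in> borel_measurable M"
  shows Re_char: "Re (char (distr M borel f) t) = expectation (\<lambda>\<omega>. cos (t * f \<omega>))"
    and Im_char: "Im (char (distr M borel f) t) = expectation (\<lambda>\<omega>. sin (t * f \<omega>))"
  unfolding char_distr[OF assms]
  using integrable_iexp_times[OF assms, of t]
  by (simp_all add: integral_Re[symmetric] integral_Im[symmetric] Re_exp Im_exp
      del: integral_Re integral_Im)

lemma char_scale:
  assumes [measurable]: "f \<in> borel_measurable M"
  shows "char (distr M borel (\<lambda>\<omega>. c * f \<omega>)) t = char (distr M borel f) (t * c)"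
  by (simp add: char_distr mult.assoc)

lemma cmod_char_distr_le_1:
  assumes [measurable]: "f \<in> borel_measurable M"
  shows "cmod (char (distr M borel f) t) \<le> 1"
proof -
  have "real_distribution (distr M borel f)" by simp
  then show ?thesis by (rule real_distribution.cmod_char_le_1)
qed

lemma char_perturbation:
  assumes [measurable]: "f \<in> borel_measurable M" and d: "square_integrable M d"
  shows "cmod (char (distr M borel (\<lambda>\<omega>. f \<omega> + d \<omega>)) t - char (distr M borel f) t)
    \<le> \<bar>t\<bar> * sqrt (expectation (\<lambda>\<omega>. (d \<omega>)\<^sup>2))"
proof -
  have [measurable]: "d \<in> borel_measurable M" using d by (simp add: square_integrable_def)
  have int_d: "integrable M (\<lambda>\<omega>. \<bar>d \<omega>\<bar>)" using square_integrable_integrable[OF d] by simp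
  have "cmod (char (distr M borel (\<lambda>\<omega>. f \<omega> + d \<omega>)) t - char (distr M borel f) t)
      = cmod (CLINT \<omega>|M. iexp (t * (f \<omega> + d \<omega>)) - iexp (t * f \<omega>))"
  proof -
    have fd: "(\<lambda>\<omega>. f \<omega> + d \<omega>) \<in> borel_measurable M" by measurable
    show ?thesis
      unfolding char_distr[OF fd] char_distr[OF assms(1)]
      by (simp only: Bochner_Integration.integral_diff integrable_iexp_times fd assms(1))
  qed
  also have "\<dots> \<le> expectation (\<lambda>\<omega>. cmod (iexp (t * (f \<omega> + d \<omega>)) - iexp (t * f \<omega>)))"
    by (rule integral_norm_bound)
  also have "\<dots> \<le> expectation (\<lambda>\<omega>. \<bar>t\<bar> * \<bar>d \<omega>\<bar>)"
  proof (rule integral_mono)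
    fix \<omega>
    have "iexp (t * (f \<omega> + d \<omega>)) - iexp (t * f \<omega>) = iexp (t * f \<omega>) * (iexp (t * d \<omega>) - 1)"
      by (simp add: exp_add[symmetric] algebra_simps)
    then have "cmod (iexp (t * (f \<omega> + d \<omega>)) - iexp (t * f \<omega>)) = cmod (iexp (t * d \<omega>) - 1)"
      by (simp only: norm_mult norm_exp_i_times mult_1)
    also have "\<dots> \<le> \<bar>t * d \<omega>\<bar>"
      using iexp_approx1[of "t * d \<omega>" 0] by simp
    finally show "cmod (iexp (t * (f \<omega> + d \<omega>)) - iexp (t * f \<omega>)) \<le> \<bar>t\<bar> * \<bar>d \<omega>\<bar>"
      by (simp add: abs_mult)
  next
    have "integrable M (\<lambda>\<omega>. iexp (t * (f \<omega> + d \<omega>)) - iexp (t * f \<omega>))"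
      by (intro Bochner_Integration.integrable_diff integrable_iexp_times) auto
    then show "integrable M (\<lambda>\<omega>. cmod (iexp (t * (f \<omega> + d \<omega>)) - iexp (t * f \<omega>)))"
      by (rule integrable_norm)
  qed (use int_d in simp)
  also have "\<dots> = \<bar>t\<bar> * expectation (\<lambda>\<omega>. \<bar>d \<omega>\<bar>)" by simp
  also have "\<dots> \<le> \<bar>t\<bar> * sqrt (expectation (\<lambda>\<omega>. (d \<omega>)\<^sup>2))"
  proof (rule mult_left_mono)
    have "\<bar>expectation (\<lambda>\<omega>. \<bar>d \<omega>\<bar> * 1)\<bar> \<le> sqrt (expectation (\<lambda>\<omega>. \<bar>d \<omega>\<bar>\<^sup>2) * expectation (\<lambda>\<omega>. 1\<^sup>2))"
      using d by (intro Cauchy_Schwarz_integral) (auto simp: square_integrable_def)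
    then show "expectation (\<lambda>\<omega>. \<bar>d \<omega>\<bar>) \<le> sqrt (expectation (\<lambda>\<omega>. (d \<omega>)\<^sup>2))"
      by (simp add: prob_space)
  qed simp
  finally show ?thesis .
qed

end

context sum_mixing
begin

text \<open>
  Splitting the exponentials into cosines and sines leaves four covariances of functions bounded
  by one.
\<close>

lemma char_separated:
  assumes n: "1 \<le> n" and fin: "finite Q" "finite R" and sep: "separated u n Q R"
  shows "cmod (char (distr M borel (S (Q \<union> R))) t
    - char (distr M borel (S Q)) t * char (distr M borel (S R)) t) \<le> 4 * r n"
proof -
  have sum: "S (Q \<union> R) \<omega> = S Q \<omega> + S R \<omega>" for \<omega>
    unfolding field_sum_def using fin separated_disjoint[OF sep n] by (intro sum.union_disjoint)
  define E where "E f g = expectation (\<lambda>\<omega>. f (t * S Q \<omega>) * g (t * S R \<omega>))" for f g :: "real \<Rightarrow> real"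
  define EQ ER where "EQ f = expectation (\<lambda>\<omega>. f (t * S Q \<omega>))" and "ER f = expectation (\<lambda>\<omega>. f (t * S R \<omega>))"
    for f :: "real \<Rightarrow> real"
  have int: "integrable M (\<lambda>\<omega>. f (t * S Q \<omega>) * g (t * S R \<omega>))"
    and cov: "\<bar>E f g - EQ f * ER g\<bar> \<le> r n"
    if [measurable]: "f \<in> borel_measurable borel" "g \<in> borel_measurable borel"
      and bd: "\<And>x. \<bar>f x\<bar> \<le> 1" "\<And>x. \<bar>g x\<bar> \<le> 1" for f g :: "real \<Rightarrow> real"
  proof -
    show "integrable M (\<lambda>\<omega>. f (t * S Q \<omega>) * g (t * S R \<omega>))"
      by (intro integrable_const_bound[where B = 1] AE_I2) (use bd in \<open>auto simp: abs_mult intro: mult_le_one\<close>)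
    have sq: "integrable M (\<lambda>\<omega>. (h (t * S P \<omega>))\<^sup>2)" "expectation (\<lambda>\<omega>. (h (t * S P \<omega>))\<^sup>2) \<le> 1"
      if [measurable]: "h \<in> borel_measurable borel" and h: "\<And>x. \<bar>h x\<bar> \<le> 1" for h :: "real \<Rightarrow> real" and P
    proof -
      have h2: "(h x)\<^sup>2 \<le> 1" for x using h[of x] by (simp add: abs_square_le_1)
      show *: "integrable M (\<lambda>\<omega>. (h (t * S P \<omega>))\<^sup>2)"
        by (intro integrable_const_bound[where B = 1] AE_I2) (use h2 in auto)
      have "expectation (\<lambda>\<omega>. (h (t * S P \<omega>))\<^sup>2) \<le> expectation (\<lambda>\<omega>. 1)"
        by (intro integral_mono * h2) simp
      then show "expectation (\<lambda>\<omega>. (h (t * S P \<omega>))\<^sup>2) \<le> 1" by (simp add: prob_space)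
    qed
    have "\<bar>E f g - EQ f * ER g\<bar> \<le> r n * sqrt (expectation (\<lambda>\<omega>. (f (t * S Q \<omega>))\<^sup>2)
        * expectation (\<lambda>\<omega>. (g (t * S R \<omega>))\<^sup>2))"
      unfolding E_def EQ_def ER_def
      by (rule mixing[OF n fin sep, of "\<lambda>x. f (t * x)" "\<lambda>x. g (t * x)"])
         (use sq bd in \<open>auto simp: square_integrable_def\<close>)
    also have "\<dots> \<le> r n * sqrt (1 * 1)"
      using sq bd by (intro mult_left_mono real_sqrt_le_mono mult_mono r_nonneg) auto
    finally show "\<bar>E f g - EQ f * ER g\<bar> \<le> r n" by simp
  qed
  let ?z = "char (distr M borel (S (Q \<union> R))) t - char (distr M borel (S Q)) t * char (distr M borel (S R)) t"
  have "Re ?z = (E cos cos - EQ cos * ER cos) - (E sin sin - EQ sin * ER sin)"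
    by (simp add: Re_char Im_char sum distrib_left cos_add int E_def EQ_def ER_def)
  then have "\<bar>Re ?z\<bar> \<le> 2 * r n"
    using cov[of cos cos] cov[of sin sin] by simp
  moreover have "Im ?z = (E sin cos - EQ sin * ER cos) + (E cos sin - EQ cos * ER sin)"
    by (simp add: Re_char Im_char sum distrib_left sin_add int E_def EQ_def ER_def)
  then have "\<bar>Im ?z\<bar> \<le> 2 * r n"
    using cov[of sin cos] cov[of cos sin] by simp
  ultimately show ?thesis using cmod_le[of ?z] by linarith
qed

lemma char_blocks:
  assumes "1 \<le> q"
  shows "cmod (char (distr M borel (S (slab L u (blocks p q m)))) t
    - char (distr M borel (S (lattice_box (resize L u p)))) t ^ m) \<le> 4 * real m * r q"
proof (induction m)
  case 0
  have "blocks p q 0 = {}" by (simp add: blocks_def)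
  then have "slab L u (blocks p q 0) = {}" by (simp add: slab_def)
  moreover have "char (distr M borel (S {})) t = 1"
    by (subst char_distr) (simp_all add: S_empty prob_space)
  ultimately show ?case by simp
next
  case (Suc m)
  let ?B = "slab L u (blocks p q m)" and ?C = "slab L u (block p q m)"
  define z where "z = char (distr M borel (S (lattice_box (resize L u p)))) t"
  define y where "y = char (distr M borel (S ?B)) t"
  have z: "char (distr M borel (S ?C)) t = z" by (simp add: z_def distr_S_block)
  have z1: "cmod z \<le> 1" unfolding z_def by (rule cmod_char_distr_le_1) simp
  have "slab L u (blocks p q (Suc m)) = ?B \<union> ?C"
    unfolding slab_Un[symmetric] by (simp add: blocks_def lessThan_Suc Un_commute)
  moreover have "separated u q ?B ?C"
    unfolding blocks_def slab_UN separated_def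
    using separated_slab_blocks[of _ m u q L p, unfolded separated_def] by fastforce
  ultimately have "cmod (char (distr M borel (S (slab L u (blocks p q (Suc m))))) t - y * z) \<le> 4 * r q"
    using char_separated[OF assms, of ?B ?C u t] by (simp add: z y_def finite_slab finite_blocks finite_block)
  moreover have "cmod (y * z - z ^ Suc m) \<le> 4 * real m * r q"
  proof -
    have "cmod (y * z - z ^ Suc m) = cmod (y - z ^ m) * cmod z"
      by (simp add: norm_mult[symmetric] algebra_simps)
    also have "\<dots> \<le> cmod (y - z ^ m) * 1" using z1 by (intro mult_left_mono) auto
    finally show ?thesis using Suc.IH by (simp add: y_def z_def)
  qed
  ultimately show ?case
    using norm_triangle_ineq[of "char (distr M borel (S (slab L u (blocks p q (Suc m))))) t - y * z" "y * z - z ^ Suc m"]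
    by (simp add: z_def[symmetric] algebra_simps)
qed

text \<open>
  The first error term comes from deleting the gaps, the second from decoupling the \<open>m\<close> blocks one
  after the other.
\<close>

lemma char_box_power:
  fixes L :: "nat ^ 'd"
  assumes K: "\<And>Q. finite Q \<Longrightarrow> expectation (\<lambda>\<omega>. (S Q \<omega>)\<^sup>2) \<le> K * real (card Q)"
    and q: "1 \<le> q" and m: "m * (p + q) \<le> L $ u + q"
  shows "cmod (char (distr M borel (S (lattice_box L))) t
    - char (distr M borel (S (lattice_box (resize L u p)))) t ^ m)
    \<le> \<bar>t\<bar> * sqrt (K * (real (L $ u - m * p) * cross L u)) + 4 * real m * r q"
proof -
  let ?B = "slab L u (blocks p q m)" and ?R = "slab L u ({1..int (L $ u)} - blocks p q m)"
  have "S (lattice_box L) = (\<lambda>\<omega>. S ?B \<omega> + S ?R \<omega>)"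
    using S_box_split[OF m] by (rule ext)
  then have "cmod (char (distr M borel (S (lattice_box L))) t - char (distr M borel (S ?B)) t)
      \<le> \<bar>t\<bar> * sqrt (expectation (\<lambda>\<omega>. (S ?R \<omega>)\<^sup>2))"
    by (simp only:) (intro char_perturbation square_integrable_S S_measurable)
  also have "\<dots> \<le> \<bar>t\<bar> * sqrt (K * (real (L $ u - m * p) * cross L u))"
    using K[of ?R] by (intro mult_left_mono real_sqrt_le_mono) (simp_all add: finite_slab card_slab card_rest[OF m])
  finally have "cmod (char (distr M borel (S (lattice_box L))) t - char (distr M borel (S ?B)) t)
      \<le> \<bar>t\<bar> * sqrt (K * (real (L $ u - m * p) * cross L u))" .
  moreover note char_blocks[OF q, of L u p m t]
  ultimately show ?thesis
    using norm_triangle_ineq[of "char (distr M borel (S (lattice_box L))) t - char (distr M borel (S ?B)) t"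
      "char (distr M borel (S ?B)) t - char (distr M borel (S (lattice_box (resize L u p)))) t ^ m"]
    by simp
qed

end

section \<open>The central limit theorem\<close>

context rho_mixing_field
begin

lemma char_box_quadratic:
  fixes L :: "nat ^ 'd"
  defines "V \<equiv> expectation (\<lambda>\<omega>. (S (lattice_box L) \<omega>)\<^sup>2)"
  shows "cmod (char (distr M borel (S (lattice_box L))) s - of_real (1 - s\<^sup>2 * V / 2))
    \<le> s\<^sup>2 / 6 * expectation (\<lambda>\<omega>. min (6 * (S (lattice_box L) \<omega>)\<^sup>2) (\<bar>s\<bar> * \<bar>S (lattice_box L) \<omega>\<bar> ^ 3))"
  unfolding V_def
  by (rule char_approx3')
     (use square_integrable_S[of "lattice_box L"] square_integrable_integrable[OF square_integrable_S[of "lattice_box L"]]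
       in \<open>simp_all add: expectation_S square_integrable_def\<close>)

text \<open>
  The constants are chosen in this order: the level \<open>\<epsilon>'\<close> of the truncation, then the number \<open>m\<close> of
  blocks, then the gap \<open>q\<close>, and last the size of the box. The blocks lie along one arbitrary
  direction \<open>u\<close>, and their length \<open>p\<close> is whatever \<open>m\<close> blocks with gaps \<open>q\<close> leave room for; thus \<open>p\<close> grows
  with the box and the variance of a block approaches its limit too.
\<close>

lemma char_tendsto_normal:
  assumes lim: "((\<lambda>L. expectation (\<lambda>\<omega>. (S (lattice_box L) \<omega>)\<^sup>2) / box_vol L) \<longlongrightarrow> v) min_at_top"
    and v: "v \<ge> 0"
  shows "((\<lambda>L. char (distr M borel (S (lattice_box L))) (t / sqrt (box_vol L)))
    \<longlongrightarrow> of_real (exp (- (v * t\<^sup>2) / 2))) min_at_top"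
proof (rule tendstoI)
  fix \<epsilon> :: real assume \<epsilon>: "\<epsilon> > 0"
  define \<delta> where "\<delta> = \<epsilon> / 6"
  have \<delta>: "\<delta> > 0" using \<epsilon> by (simp add: \<delta>_def)
  have t1: "0 < t\<^sup>2 + 1" by (simp add: add_nonneg_pos)
  define G where "G L = expectation (\<lambda>\<omega>. (S (lattice_box L) \<omega>)\<^sup>2) / box_vol L" for L
  obtain K where K: "K > 0" "\<And>Q. finite Q \<Longrightarrow> expectation (\<lambda>\<omega>. (S Q \<omega>)\<^sup>2) \<le> K * real (card Q)"
    using second_moment_le_card by blast
  have EK: "expectation (\<lambda>\<omega>. (S (lattice_box L) \<omega>)\<^sup>2) \<le> K * box_vol L" for L
    using K(2)[OF finite_box, of L] by (simp add: card_box)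
  have GK: "G L \<le> K" for L
    using EK[of L] box_vol_nonneg[of L] K(1)
    by (cases "box_vol L = 0") (auto simp: G_def divide_le_eq)
  have vK: "v \<le> K"
  proof (rule tendsto_upperbound[OF lim])
    show "\<forall>\<^sub>F L in min_at_top. expectation (\<lambda>\<omega>. (S (lattice_box L) \<omega>)\<^sup>2) / box_vol L \<le> K"
      using GK by (simp add: G_def)
    show "min_at_top \<noteq> (bot :: (nat ^ 'd) filter)"
    proof
      assume "min_at_top = (bot :: (nat ^ 'd) filter)"
      then have "eventually (\<lambda>_. False) (min_at_top :: (nat ^ 'd) filter)" by simp
      then obtain N where "\<And>L :: nat ^ 'd. \<not> (\<forall>v. N \<le> L $ v)"
        unfolding eventually_min_at_top by blast
      from this[of "\<chi> v. N"] show False by simp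
    qed
  qed
  define \<epsilon>' where "\<epsilon>' = 3 * \<delta> / (t\<^sup>2 + 1)"
  have \<epsilon>': "\<epsilon>' > 0" using \<delta> t1 by (simp add: \<epsilon>'_def)
  obtain C where C: "C \<ge> 0" "\<And>L s. s \<ge> 0 \<Longrightarrow>
    expectation (\<lambda>\<omega>. min (6 * (S (lattice_box L) \<omega>)\<^sup>2) (s * \<bar>S (lattice_box L) \<omega>\<bar> ^ 3))
      \<le> box_vol L * (\<epsilon>' + C * s * sqrt (box_vol L))"
    using truncated_third_moment_bound[OF \<epsilon>'] by blast
  obtain m :: nat where m: "1 \<le> m" "K * t\<^sup>2 \<le> m"
    "t\<^sup>2 / 6 * (C * \<bar>t\<bar>) / sqrt m \<le> \<delta> / 2"
    "\<bar>(1 + (- (v * t\<^sup>2) / 2) / m) ^ m - exp (- (v * t\<^sup>2) / 2)\<bar> \<le> \<delta>"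
  proof -
    have "(\<lambda>m. t\<^sup>2 / 6 * (C * \<bar>t\<bar>) / sqrt (real m)) \<longlonglongrightarrow> 0"
      by (intro tendsto_divide_0[OF tendsto_const] filterlim_at_top_imp_at_infinity
          filterlim_compose[OF sqrt_at_top filterlim_real_sequentially])
    then have "\<forall>\<^sub>F m in sequentially. t\<^sup>2 / 6 * (C * \<bar>t\<bar>) / sqrt (real m) < \<delta> / 2"
      using \<delta> by (intro order_tendstoD) auto
    moreover have "\<forall>\<^sub>F m in sequentially.
        dist ((1 + (- (v * t\<^sup>2) / 2) / real m) ^ m) (exp (- (v * t\<^sup>2) / 2)) < \<delta>"
      by (rule tendstoD[OF tendsto_exp_limit_sequentially \<delta>])
    moreover have "\<forall>\<^sub>F m in sequentially. K * t\<^sup>2 \<le> real m"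
      using filterlim_real_sequentially by (auto simp: filterlim_at_top)
    moreover have "\<forall>\<^sub>F m::nat in sequentially. 1 \<le> m" by (rule eventually_ge_at_top)
    ultimately have "\<forall>\<^sub>F m in sequentially. 1 \<le> m \<and> K * t\<^sup>2 \<le> real m \<and>
        t\<^sup>2 / 6 * (C * \<bar>t\<bar>) / sqrt (real m) \<le> \<delta> / 2 \<and>
        \<bar>(1 + (- (v * t\<^sup>2) / 2) / real m) ^ m - exp (- (v * t\<^sup>2) / 2)\<bar> \<le> \<delta>"
      by eventually_elim (simp add: dist_real_def)
    then show ?thesis using that eventually_happens'[OF sequentially_bot] by blast
  qed
  obtain q where q: "1 \<le> q" "\<bar>rho_prime M X q\<bar> \<le> \<delta> / (4 * m)"
    using r_small[of "\<delta> / (4 * m)"] m \<delta> by auto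
  have "\<delta> / (t\<^sup>2 + 1) > 0" using \<delta> t1 by simp
  then have "\<forall>\<^sub>F L in min_at_top. dist (G L) v < \<delta> / (t\<^sup>2 + 1)"
    using tendstoD[OF lim] by (simp add: G_def)
  then obtain N0 where N0: "\<And>L. (\<And>u. N0 \<le> L $ u) \<Longrightarrow> \<bar>G L - v\<bar> \<le> \<delta> / (t\<^sup>2 + 1)"
    unfolding eventually_min_at_top dist_real_def by (meson less_imp_le)
  define g where "g = K * (real m * (real q + 1))"
  have g: "g \<ge> 0" using K by (simp add: g_def)
  obtain N1 :: nat where N1: "t\<^sup>2 * g / \<delta>\<^sup>2 \<le> N1" "g * (t\<^sup>2 + 1) / \<delta> \<le> N1"
    by (meson real_arch_simple max.bounded_iff)
  have main: "cmod (char (distr M borel (S (lattice_box L))) (t / sqrt (box_vol L))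
      - of_real (exp (- (v * t\<^sup>2) / 2))) \<le> 5 * \<delta>"
    if L: "\<And>u. m * (N0 + q + 1) + N0 + N1 + 1 \<le> L $ u" for L :: "nat ^ 'd"
  proof -
    fix u :: 'd
    define N c p where "N = real (L $ u)" and "c = cross L u" and "p = L $ u div m - q"
    have Lpos: "L $ v > 0" for v using L[of v] by simp
    have N: "N > 0" "N1 \<le> N" using L[of u] Lpos[of u] by (auto simp: N_def)
    have gN1: "t\<^sup>2 * g / \<delta>\<^sup>2 \<le> N" "g * (t\<^sup>2 + 1) / \<delta> \<le> N"
      using N1 N(2) by linarith+
    have c: "c > 0" unfolding c_def by (rule cross_pos) (rule Lpos)
    have vol: "box_vol L = N * c" by (simp add: box_vol_cross[of L u] N_def c_def)
    have "m * (N0 + q + 1) \<le> L $ u" using L[of u] by simp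
    then have "N0 + q + 1 \<le> L $ u div m" using m by (simp add: less_eq_div_iff_mult_less_eq mult.commute)
    then have p: "N0 \<le> p" "1 \<le> p" and pq: "p + q = L $ u div m" by (auto simp: p_def)
    have mpq: "m * (p + q) \<le> L $ u" unfolding pq by simp
    have mp_nat: "m * p \<le> L $ u" using mpq by (rule order_trans[rotated]) simp
    have mp: "real m * p \<le> N" using mp_nat by (simp add: N_def flip: of_nat_mult)
    have rest: "N - real m * p \<le> real m * (real q + 1)"
    proof -
      have "L $ u < m * (p + q) + m"
        unfolding pq using m dividend_less_times_div[of m "L $ u"] by simp
      then have "real (L $ u) \<le> real (m * (p + q) + m)" by (simp only: of_nat_le_iff less_imp_le)
      then show ?thesis by (simp add: N_def algebra_simps)
    qed
    have gN: "K * (N - real m * p) \<le> g" unfolding g_def using rest K by simp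
    define s where "s = t / sqrt (N * c)"
    have s2: "s\<^sup>2 = t\<^sup>2 / (N * c)" using N c by (simp add: s_def power_divide)
    define w V where "w = box_vol (resize L u p)" and "V = expectation (\<lambda>\<omega>. (S (lattice_box (resize L u p)) \<omega>)\<^sup>2)"
    have w: "w = p * c" by (simp add: w_def box_vol_resize c_def)
    have w0: "w > 0" using p c by (simp add: w)
    have s2w: "real m * (s\<^sup>2 * w) \<le> t\<^sup>2"
    proof -
      have "real m * (s\<^sup>2 * w) = t\<^sup>2 * ((real m * p) / N)" using N c by (simp add: s2 w field_simps)
      also have "\<dots> \<le> t\<^sup>2 * 1" using mp N by (intro mult_left_mono) auto
      finally show ?thesis by simp
    qed
    have sw: "\<bar>s\<bar> * sqrt w \<le> \<bar>t\<bar> / sqrt m"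
    proof -
      have "s\<^sup>2 * w \<le> t\<^sup>2 / m" using s2w m by (simp add: field_simps)
      then have "sqrt (s\<^sup>2 * w) \<le> sqrt (t\<^sup>2 / m)" by (rule real_sqrt_le_mono)
      then show ?thesis by (simp add: real_sqrt_mult real_sqrt_divide)
    qed
    have V: "0 \<le> V" "V \<le> K * w" using EK[of "resize L u p"] by (auto simp: V_def w_def)
    define z zp where "z = char (distr M borel (S (lattice_box L))) s"
      and "zp = char (distr M borel (S (lattice_box (resize L u p)))) s"
    define x y where "x = 1 - s\<^sup>2 * V / 2" and "y = 1 - v * t\<^sup>2 / (2 * m)"
    \<comment> \<open>Deleting the gaps costs at most \<open>\<delta>\<close>, decoupling the blocks at most another \<open>\<delta>\<close>.\<close>
    have 1: "cmod (z - zp ^ m) \<le> 2 * \<delta>"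
    proof -
      have "cmod (z - zp ^ m) \<le> \<bar>s\<bar> * sqrt (K * (real (L $ u - m * p) * cross L u)) + 4 * real m * \<bar>rho_prime M X q\<bar>"
        unfolding z_def zp_def
        by (rule char_box_power[OF K(2) q(1)]) (use mpq in linarith)+
      also have "real (L $ u - m * p) = N - real m * p"
        using mp_nat by (simp add: N_def of_nat_diff)
      also have "\<bar>s\<bar> * sqrt (K * ((N - real m * p) * cross L u)) = sqrt (t\<^sup>2 * (K * (N - real m * p)) / N)"
      proof -
        have "\<bar>s\<bar> * sqrt (K * ((N - real m * p) * c)) = sqrt (s\<^sup>2 * (K * ((N - real m * p) * c)))"
          by (simp add: real_sqrt_mult)
        also have "s\<^sup>2 * (K * ((N - real m * p) * c)) = t\<^sup>2 * (K * (N - real m * p)) / N"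
          using N c by (simp add: s2 field_simps)
        finally show ?thesis by (simp add: c_def)
      qed
      also have "\<dots> \<le> \<delta>"
      proof (rule real_le_lsqrt)
        have "t\<^sup>2 * (K * (N - real m * p)) \<le> t\<^sup>2 * g" using gN by (intro mult_left_mono) auto
        also have "t\<^sup>2 * g \<le> N * \<delta>\<^sup>2" using gN1(1) \<delta> by (simp add: field_simps)
        finally show "t\<^sup>2 * (K * (N - real m * p)) / N \<le> \<delta>\<^sup>2" using N by (simp add: field_simps)
      qed (use \<delta> K mp N in auto)
      also have "4 * real m * \<bar>rho_prime M X q\<bar> \<le> \<delta>" using q m by (simp add: field_simps)
      finally show ?thesis by simp
    qed
    \<comment> \<open>Powers of numbers in the unit disc differ by at most \<open>m\<close> times the difference of the bases; \<open>m \<ge> K t\<^sup>2\<close> puts \<open>x\<close> into the disc.\<close>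
    have x1: "\<bar>x\<bar> \<le> 1"
    proof -
      have "s\<^sup>2 * V \<le> s\<^sup>2 * (K * w)" using V by (intro mult_left_mono) auto
      also have "\<dots> \<le> 1"
      proof -
        have "real m * (s\<^sup>2 * (K * w)) \<le> K * t\<^sup>2"
          using mult_left_mono[OF s2w, of K] K by (simp add: ac_simps)
        then have "real m * (s\<^sup>2 * (K * w)) \<le> real m * 1" using m(2) by linarith
        then show ?thesis using m(1) by (subst (asm) mult_le_cancel_left_pos) simp_all
      qed
      finally show ?thesis using V by (simp add: x_def abs_le_iff)
    qed
    have 2: "cmod (zp ^ m - of_real x ^ m) \<le> \<delta>"
    proof -
      have "cmod (zp - of_real x) \<le> s\<^sup>2 / 6 * (w * (\<epsilon>' + C * \<bar>s\<bar> * sqrt w))"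
        unfolding zp_def x_def V_def
        by (rule order_trans[OF char_box_quadratic mult_left_mono]) (use C(2)[of "\<bar>s\<bar>" "resize L u p"] in \<open>auto simp: w_def\<close>)
      then have "real m * cmod (zp - of_real x) \<le> real m * (s\<^sup>2 / 6 * (w * (\<epsilon>' + C * \<bar>s\<bar> * sqrt w)))"
        by (intro mult_left_mono) auto
      also have "\<dots> = (real m * (s\<^sup>2 * w)) * ((\<epsilon>' + C * (\<bar>s\<bar> * sqrt w)) / 6)" by simp
      also have "\<dots> \<le> t\<^sup>2 * ((\<epsilon>' + C * (\<bar>t\<bar> / sqrt m)) / 6)"
        using s2w sw C(1) \<epsilon>' w0 by (intro mult_mono divide_right_mono add_left_mono mult_left_mono) auto
      also have "\<dots> = t\<^sup>2 / 6 * \<epsilon>' + t\<^sup>2 / 6 * (C * \<bar>t\<bar>) / sqrt m" by (simp add: algebra_simps add_divide_distrib)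
      also have "\<dots> \<le> \<delta> / 2 + \<delta> / 2"
      proof (rule add_mono[OF _ m(3)])
        show "t\<^sup>2 / 6 * \<epsilon>' \<le> \<delta> / 2" using t1 \<delta> by (simp add: \<epsilon>'_def field_simps)
      qed
      finally have "real m * cmod (zp - of_real x) \<le> \<delta>" by simp
      moreover have "cmod (zp ^ m - of_real x ^ m) \<le> real m * cmod (zp - of_real x)"
        using x1 by (intro norm_power_diff) (auto simp: zp_def intro: cmod_char_distr_le_1)
      ultimately show ?thesis by linarith
    qed
    \<comment> \<open>The exponent \<open>m * s\<^sup>2 * V / 2\<close> tends to \<open>v * t\<^sup>2 / 2\<close> because the block is itself a large box and the blocks fill almost all of \<open>N\<close>.\<close>
    have y1: "\<bar>y\<bar> \<le> 1"
    proof -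
      have "v * t\<^sup>2 \<le> K * t\<^sup>2" using vK by (intro mult_right_mono) auto
      with m have "v * t\<^sup>2 / (2 * m) \<le> 1" by (simp add: field_simps)
      then show ?thesis using v by (simp add: y_def abs_le_iff)
    qed
    have 3: "\<bar>x ^ m - y ^ m\<bar> \<le> \<delta>"
    proof -
      define G' where "G' = G (resize L u p)"
      have G': "0 \<le> G'" "G' \<le> K" using GK V w0 by (auto simp: G'_def G_def V_def w_def)
      have "\<And>v. N0 \<le> resize L u p $ v" using p L by (auto simp: resize_nth intro: order_trans[OF _ L])
      then have near: "\<bar>G' - v\<bar> \<le> \<delta> / (t\<^sup>2 + 1)" unfolding G'_def by (rule N0)
      have VG: "V = G' * w" using w0 by (simp add: G'_def G_def V_def w_def)
      have "real m * (y - x) = t\<^sup>2 / 2 * ((real m * p) / N * G' - v)"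
        using N c m by (simp add: x_def y_def VG s2 w field_simps)
      also have "(real m * p) / N * G' - v = (G' - v) - (N - real m * p) / N * G'"
        using N by (simp add: field_simps)
      finally have "real m * (y - x) = t\<^sup>2 / 2 * ((G' - v) - (N - real m * p) / N * G')" .
      moreover have "\<bar>(G' - v) - (N - real m * p) / N * G'\<bar> \<le> 2 * (\<delta> / (t\<^sup>2 + 1))"
      proof -
        have "(N - real m * p) / N * G' \<le> (N - real m * p) / N * K"
          using G' mp N by (intro mult_left_mono) auto
        also have "\<dots> = K * (N - real m * p) / N" by simp
        also have "\<dots> \<le> g / N" using gN N by (intro divide_right_mono) auto
        also have "\<dots> \<le> \<delta> / (t\<^sup>2 + 1)" using gN1(2) N \<delta> t1 by (simp add: field_simps)
        finally have "(N - real m * p) / N * G' \<le> \<delta> / (t\<^sup>2 + 1)" .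
        moreover have "0 \<le> (N - real m * p) / N * G'" using G' mp N by auto
        moreover have "\<bar>a - b\<bar> \<le> 2 * d" if "b \<le> d" "0 \<le> b" "\<bar>a\<bar> \<le> d" for a b d :: real
          using that by linarith
        ultimately show ?thesis using near by blast
      qed
      ultimately have "\<bar>real m * (y - x)\<bar> \<le> t\<^sup>2 / 2 * (2 * (\<delta> / (t\<^sup>2 + 1)))"
        by (simp only: abs_mult) (intro mult_mono, simp_all)
      then have "real m * \<bar>y - x\<bar> \<le> t\<^sup>2 / 2 * (2 * (\<delta> / (t\<^sup>2 + 1)))"
        by (simp only: abs_mult abs_of_nat)
      also have "\<dots> \<le> \<delta>" using \<delta> t1 by (simp add: field_simps)
      finally have "real m * \<bar>x - y\<bar> \<le> \<delta>" by (simp only: abs_minus_commute)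
      then show ?thesis using norm_power_diff[of x y m] x1 y1 by simp
    qed
    have 4: "\<bar>y ^ m - exp (- (v * t\<^sup>2) / 2)\<bar> \<le> \<delta>"
      using m(4) by (simp add: y_def)
    let ?e = "exp (- (v * t\<^sup>2) / 2)"
    have "z - of_real ?e = (z - zp ^ m) + (zp ^ m - of_real x ^ m) + (of_real (x ^ m - y ^ m) + of_real (y ^ m - ?e))"
      by simp
    also have "cmod \<dots> \<le> cmod (z - zp ^ m) + cmod (zp ^ m - of_real x ^ m) + (\<bar>x ^ m - y ^ m\<bar> + \<bar>y ^ m - ?e\<bar>)"
      by (intro norm_triangle_mono order_refl) (simp_all only: norm_of_real order_refl)
    finally show "cmod (char (distr M borel (S (lattice_box L))) (t / sqrt (box_vol L)) - of_real ?e) \<le> 5 * \<delta>"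
      using 1 2 3 4 by (simp add: z_def s_def vol)
  qed
  show "\<forall>\<^sub>F L in min_at_top. dist (char (distr M borel (S (lattice_box L))) (t / sqrt (box_vol L)))
      (of_real (exp (- (v * t\<^sup>2) / 2))) < \<epsilon>"
    unfolding eventually_min_at_top
  proof (intro exI allI impI)
    fix L :: "nat ^ 'd" assume "\<forall>u. m * (N0 + q + 1) + N0 + N1 + 1 \<le> L $ u"
    then have "cmod (char (distr M borel (S (lattice_box L))) (t / sqrt (box_vol L))
      - of_real (exp (- (v * t\<^sup>2) / 2))) \<le> 5 * \<delta>" by (intro main) auto
    also have "5 * \<delta> < \<epsilon>" using \<epsilon> by (simp add: \<delta>_def)
    finally show "dist (char (distr M borel (S (lattice_box L))) (t / sqrt (box_vol L)))
      (of_real (exp (- (v * t\<^sup>2) / 2))) < \<epsilon>" by (simp add: dist_norm)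
  qed
qed

end

lemma
  assumes "v \<ge> 0"
  shows real_distribution_normal_law: "real_distribution (normal_law v)"
    and char_normal_law: "char (normal_law v) t = of_real (exp (- (v * t\<^sup>2) / 2))"
proof -
  show "real_distribution (normal_law v)"
  proof (cases "v = 0")
    case True
    have "prob_space (return borel (0 :: real))" by (rule prob_space_return) simp
    then show ?thesis
      by (simp add: normal_law_def True real_distribution_def real_distribution_axioms_def)
  next
    case False
    have "prob_space (density lborel (normal_density 0 (sqrt v)))"
      using False assms by (intro prob_space_normal_density) simp
    then show ?thesis
      by (simp add: normal_law_def False real_distribution_def real_distribution_axioms_def)
  qed
  show "char (normal_law v) t = of_real (exp (- (v * t\<^sup>2) / 2))"
  proof (cases "v = 0")
    case True
    then show ?thesis by (simp add: normal_law_def char_def integral_return)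
  next
    case False
    then have v: "sqrt v > 0" using assms by simp
    interpret N: prob_space std_normal_distribution by (rule prob_space_normal_density) simp
    have "distributed std_normal_distribution lborel (\<lambda>x. x) (normal_density 0 1)"
      by (simp add: distributed_def distr_id2)
    \<comment> \<open>Rescaling the standard normal law reduces to its known characteristic function.\<close>
    from N.normal_density_affine[OF this, of "sqrt v" 0] v
    have "distributed std_normal_distribution lborel (\<lambda>x. sqrt v * x) (normal_density 0 (sqrt v))"
      by simp
    then have "normal_law v = distr std_normal_distribution lborel (\<lambda>x. sqrt v * x)"
      using False by (simp add: normal_law_def distributed_distr_eq_density)
    then have "char (normal_law v) t = char std_normal_distribution (t * sqrt v)"
      unfolding char_def by (simp add: integral_distr mult.assoc)
    also have "\<dots> = of_real (exp (- (v * t\<^sup>2) / 2))"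
      using assms by (simp add: char_std_normal_distribution power_mult_distrib mult.commute)
    finally show ?thesis .
  qed
qed

text \<open>Levy's theorem speaks about sequences; this reduces the directed limit to them.\<close>

lemma tendsto_min_at_top_sequentially:
  fixes f :: "nat ^ 'd \<Rightarrow> 'b :: topological_space"
  assumes "\<And>L. filterlim L min_at_top sequentially \<Longrightarrow> (\<lambda>n. f (L n)) \<longlonglongrightarrow> l"
  shows "(f \<longlongrightarrow> l) min_at_top"
proof (rule topological_tendstoI, rule ccontr)
  fix U assume U: "open U" "l \<in> U" and not: "\<not> (\<forall>\<^sub>F L in min_at_top. f L \<in> U)"
  then obtain L where L: "\<And>n. (\<forall>v. n \<le> L n $ v) \<and> f (L n) \<notin> U"
    unfolding eventually_min_at_top by metis
  have "filterlim L min_at_top sequentially"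
    unfolding filterlim_iff eventually_min_at_top
  proof safe
    fix P :: "nat ^ 'd \<Rightarrow> bool" and N assume P: "\<forall>L. (\<forall>v. N \<le> L $ v) \<longrightarrow> P L"
    show "\<forall>\<^sub>F n in sequentially. P (L n)"
      using L P by (intro eventually_sequentiallyI[of N]) (meson order_trans)
  qed
  then have "\<forall>\<^sub>F n in sequentially. f (L n) \<in> U"
    using topological_tendstoD[OF assms U] by blast
  with L show False by (simp add: eventually_sequentially)
qed

theorem theorem3p1:
  fixes M :: "'a measure" and X :: "int ^ 'd \<Rightarrow> 'a \<Rightarrow> real"
  assumes "prob_space M"
    and "random_field M X"
    and "strictly_stationary M X"
    and "rho_prime_mixing M X"
    and "integrable M (\<lambda>\<omega>. (X 0 \<omega>)\<^sup>2)"
    and "prob_space.expectation M (X 0) = 0"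
  shows "\<exists>v\<ge>0.
    ((\<lambda>L. prob_space.expectation M (\<lambda>\<omega>. (box_sum X L \<omega>)\<^sup>2) / box_vol L) \<longlongrightarrow> v) min_at_top \<and>
    weak_conv_filter
      (\<lambda>L. distr M borel (\<lambda>\<omega>. box_vol L powr (- 1 / 2) * box_sum X L \<omega>))
      (normal_law v) min_at_top"
proof -
  interpret rho_mixing_field M X
    using assms by (simp add: rho_mixing_field_def rho_mixing_field_axioms_def)
  have sum: "box_sum X L = S (lattice_box L)" for L
    by (simp add: box_sum_def[abs_def] field_sum_def[abs_def] lattice_box_def)
  obtain v where v: "v \<ge> 0"
    and lim: "((\<lambda>L. expectation (\<lambda>\<omega>. (S (lattice_box L) \<omega>)\<^sup>2) / box_vol L) \<longlongrightarrow> v) min_at_top"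
    by (rule normalized_variance_converges)
  let ?\<mu> = "\<lambda>L. distr M borel (\<lambda>\<omega>. box_vol L powr (- 1 / 2) * box_sum X L \<omega>)"
  have char: "((\<lambda>L. char (?\<mu> L) t) \<longlongrightarrow> char (normal_law v) t) min_at_top" for t
  proof -
    have "char (?\<mu> L) t = char (distr M borel (S (lattice_box L))) (t / sqrt (box_vol L))"
      if "\<forall>u. 1 \<le> L $ u" for L
    proof -
      have "box_vol L > 0" using that by (intro box_vol_pos) (simp add: Suc_le_eq)
      then have "box_vol L powr (- 1 / 2) = 1 / sqrt (box_vol L)"
        by (simp add: powr_minus_divide powr_half_sqrt)
      then show ?thesis by (simp only: sum char_scale[OF S_measurable]) simp
    qed
    then have "\<forall>\<^sub>F L in min_at_top. char (distr M borel (S (lattice_box L))) (t / sqrt (box_vol L)) = char (?\<mu> L) t"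
      unfolding eventually_min_at_top by (intro exI[of _ 1]) auto
    then show ?thesis
      unfolding char_normal_law[OF v] by (rule Lim_transform_eventually[OF char_tendsto_normal[OF lim v]])
  qed
  have "weak_conv_filter ?\<mu> (normal_law v) min_at_top"
    unfolding weak_conv_filter_def
  proof (intro allI impI tendsto_min_at_top_sequentially)
    fix x and L :: "nat \<Rightarrow> nat ^ 'd"
    assume x: "isCont (cdf (normal_law v)) x" and L: "filterlim L min_at_top sequentially"
    have "weak_conv_m (\<lambda>n. ?\<mu> (L n)) (normal_law v)"
    proof (rule levy_continuity)
      show "real_distribution (?\<mu> (L n))" for n unfolding sum by simp
      show "real_distribution (normal_law v)" by (rule real_distribution_normal_law[OF v])
      show "(\<lambda>n. char (?\<mu> (L n)) t) \<longlonglongrightarrow> char (normal_law v) t" for t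
        by (rule filterlim_compose[OF char L])
    qed
    then show "(\<lambda>n. cdf (?\<mu> (L n)) x) \<longlonglongrightarrow> cdf (normal_law v) x"
      using x by (simp add: weak_conv_m_def weak_conv_def)
  qed
  with v lim show ?thesis unfolding sum by blast
qed

end
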